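(* Let $G$ be a connected graph with $n$ vertices. If $G$ has maximum degree at most $4$, then $\mathrm{pn}(G)\le\lfloor n/2\rfloor$, or $G$ is isomorphic to $K_3$, to $K_5$, or to $K_5^-$.
   Context: All graphs are finite and simple. A path decomposition of a graph $G$ is a set of pairwise edge-disjoint paths of $G$ that together cover $E(G)$; $\mathrm{pn}(G)$ is the minimum size of a path decomposition of $G$ (it is $0$ if $G$ has no edges). $K_5^-$ is the graph obtained from $K_5$ by removing exactly one edge. *)

theory Defs
  imports "Graph_Theory.Graph_Theory"
begin

text \<open>
  A finite simple graph is a \<^locale>\<open>pair_graph\<close>: a finite, loop-free, symmetric digraph whose arcs
  are pairs of vertices. An edge between \<open>u\<close> and \<open>v\<close> is the pair of opposite arcs \<open>(u, v)\<close>, \<open>(v, u)\<close>,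
  so the degree of a vertex is its \<^const>\<open>out_degree\<close>.
\<close>

text \<open>Only meaningful for graphs with at least one vertex, since \<open>Max {}\<close> is unspecified.\<close>

definition max_degree :: "'a pair_pre_digraph \<Rightarrow> nat" where
  "max_degree G = Max (out_degree (with_proj G) ` pverts G)"

text \<open>
  A path is a subgraph, not a vertex sequence: \<open>path_graph p = path_graph (rev p)\<close>. Both orientations
  of every traversed arc belong to it, so that arc-disjointness of two paths is edge-disjointness.
\<close>

definition path_graph :: "'a list \<Rightarrow> 'a pair_pre_digraph" where
  "path_graph p = \<lparr>pverts = set p, parcs = set (vwalk_arcs p) \<union> (set (vwalk_arcs p))\<inverse>\<rparr>"

definition is_path_of :: "'a pair_pre_digraph \<Rightarrow> 'a pair_pre_digraph \<Rightarrow> bool" where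
  "is_path_of P G \<longleftrightarrow> (\<exists>p. vpath p (with_proj G) \<and> P = path_graph p)"

definition path_decomposition :: "'a pair_pre_digraph \<Rightarrow> 'a pair_pre_digraph set \<Rightarrow> bool" where
  "path_decomposition G D \<longleftrightarrow>
     (\<forall>P\<in>D. is_path_of P G) \<and>
     (\<forall>P\<in>D. \<forall>Q\<in>D. P \<noteq> Q \<longrightarrow> parcs P \<inter> parcs Q = {}) \<and>
     (\<Union>P\<in>D. parcs P) = parcs G"

definition pn :: "'a pair_pre_digraph \<Rightarrow> nat" where
  "pn G = (LEAST k. \<exists>D. path_decomposition G D \<and> card D = k)"

definition complete_graph :: "nat \<Rightarrow> nat pair_pre_digraph" where
  "complete_graph n = \<lparr>pverts = {..<n}, parcs = {(u, v). u < n \<and> v < n \<and> u \<noteq> v}\<rparr>"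

definition K5_minus :: "nat pair_pre_digraph" where
  "K5_minus = (complete_graph 5)\<lparr>parcs := parcs (complete_graph 5) - {(0, 1), (1, 0)}\<rparr>"

definition graph_iso :: "'a pair_pre_digraph \<Rightarrow> 'b pair_pre_digraph \<Rightarrow> bool" where
  "graph_iso G H \<longleftrightarrow> digraph_iso (with_proj G) (with_proj H)"


text \<open>
  A path decomposition of a finite simple graph is finite, so that \<^const>\<open>card\<close> measures its size,
  and one always exists, so that the minimum in \<^const>\<open>pn\<close> is attained.
\<close>

lemma path_decomposition_finite:
  assumes "pair_graph G" "path_decomposition G D"
  shows "finite D"
proof -
  interpret pair_graph G by fact
  have "D \<subseteq> path_graph ` {p. set p \<subseteq> pverts G \<and> distinct p}"
    using assms(2) by (auto simp: path_decomposition_def is_path_of_def vpath_def vwalk_def)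
  moreover have "finite {p. set p \<subseteq> pverts G \<and> distinct p}"
    using finite_subset_distinct[OF pair_finite_verts] .
  ultimately show ?thesis by (meson finite_imageI finite_subset)
qed

lemma path_decomposition_exists:
  assumes "pair_graph G"
  shows "\<exists>D. path_decomposition G D"
proof -
  interpret pair_graph G by fact
  have sym: "(v, u) \<in> parcs G" if "(u, v) \<in> parcs G" for u v
    using that by (simp add: arcs_symmetric)
  let ?D = "(\<lambda>(u, v). path_graph [u, v]) ` parcs G"
  have "is_path_of (path_graph [u, v]) G" if "(u, v) \<in> parcs G" for u v
  proof -
    have "u \<in> pverts G" "v \<in> pverts G" "u \<noteq> v"
      using that in_arcsD1 in_arcsD2 pair_no_loops[OF that] by simp_all
    then have "vpath [u, v] (with_proj G)"
      using that by (simp add: vpath_def vwalk_def)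
    then show ?thesis unfolding is_path_of_def by blast
  qed
  then have "\<forall>P\<in>?D. is_path_of P G" by auto
  moreover have "\<forall>P\<in>?D. \<forall>Q\<in>?D. P \<noteq> Q \<longrightarrow> parcs P \<inter> parcs Q = {}"
    by (auto simp: path_graph_def)
  moreover have "(\<Union>P\<in>?D. parcs P) = parcs G"
  proof
    show "(\<Union>P\<in>?D. parcs P) \<subseteq> parcs G"
      using sym by (auto simp: path_graph_def)
    show "parcs G \<subseteq> (\<Union>P\<in>?D. parcs P)"
    proof
      fix a assume "a \<in> parcs G"
      then show "a \<in> (\<Union>P\<in>?D. parcs P)"
        by (auto simp: path_graph_def case_prod_beta intro!: bexI[of _ a])
    qed
  qed
  ultimately have "path_decomposition G ?D"
    unfolding path_decomposition_def by (intro conjI)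
  then show ?thesis ..
qed

lemma pn_attained:
  assumes "pair_graph G"
  shows "\<exists>D. path_decomposition G D \<and> card D = pn G"
  unfolding pn_def using path_decomposition_exists[OF assms] 
  by (intro LeastI_ex[where P = "\<lambda>k. \<exists>D. path_decomposition G D \<and> card D = k"]) blast

lemma pn_edgeless: "parcs G = {} \<Longrightarrow> pn G = 0"
  unfolding pn_def
  by (rule Least_equality) (auto simp: path_decomposition_def intro!: exI[of _ "{}"])

text \<open>The library isomorphism of the underlying arc-labelled digraphs is the usual one.\<close>

lemma graph_iso_iff:
  assumes "pair_graph G"
  shows "graph_iso G H \<longleftrightarrow>
    (\<exists>f. bij_betw f (pverts G) (pverts H) \<and> parcs H = map_prod f f ` parcs G)"
proof -
  interpret pair_graph G by fact
  show ?thesis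
  proof
    assume "graph_iso G H"
    then obtain h where h: "pre_digraph.digraph_isomorphism (with_proj G) h"
      and H: "with_proj H = app_iso h (with_proj G)"
      by (auto simp: graph_iso_def digraph_iso_def)
    have t: "iso_tail h = fst" "iso_head h = snd"
      using arg_cong[OF H, of tail] arg_cong[OF H, of head] by simp_all
    have V: "pverts H = iso_verts h ` pverts G" and A: "parcs H = iso_arcs h ` parcs G"
      using arg_cong[OF H, of verts] arg_cong[OF H, of arcs] by simp_all
    have "iso_arcs h a = map_prod (iso_verts h) (iso_verts h) a" if "a \<in> parcs G" for a
      using h that t by (cases a) (auto simp: pre_digraph.digraph_isomorphism_def prod_eq_iff)
    then have "parcs H = map_prod (iso_verts h) (iso_verts h) ` parcs G"
      using A by (simp cong: image_cong)
    moreover have "bij_betw (iso_verts h) (pverts G) (pverts H)"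
      using h V by (auto simp: pre_digraph.digraph_isomorphism_def bij_betw_def)
    ultimately show "\<exists>f. bij_betw f (pverts G) (pverts H) \<and> parcs H = map_prod f f ` parcs G"
      by blast
  next
    assume "\<exists>f. bij_betw f (pverts G) (pverts H) \<and> parcs H = map_prod f f ` parcs G"
    then obtain f where f: "bij_betw f (pverts G) (pverts H)" "parcs H = map_prod f f ` parcs G"
      by blast
    let ?h = "\<lparr>iso_verts = f, iso_arcs = map_prod f f, iso_head = snd, iso_tail = fst\<rparr>"
    have inj: "inj_on f (pverts G)" using f by (simp add: bij_betw_def)
    have "inj_on (map_prod f f) (parcs G)"
      using map_prod_inj_on[OF inj inj] by (rule inj_on_subset) (auto dest: in_arcsD1 in_arcsD2)
    then have "pre_digraph.digraph_isomorphism (with_proj G) ?h"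
      using inj wf_digraph_axioms by (auto simp: pre_digraph.digraph_isomorphism_def)
    moreover have "with_proj H = app_iso ?h (with_proj G)"
      using f by (simp add: app_iso_def with_proj_def bij_betw_def)
    ultimately show "graph_iso G H"
      by (auto simp: graph_iso_def digraph_iso_def)
  qed
qed

end

theory Submission
  imports Defs
begin

text \<open>
  Call a vertex set \<^emph>\<open>exceptional\<close> if no edge leaves it and it induces \<open>K\<^sub>3\<close>, \<open>K\<^sub>5\<close> or
  \<open>K\<^sub>5\<^sup>-\<close>. Every graph of maximum degree at most 4 without exceptional sets decomposes into at most
  \<open>n/2\<close> paths, and for a connected graph an exceptional set is the whole graph.

  Consider a minimal counterexample, which is connected. The basic reduction picks two vertices \<open>a\<close>
  and \<open>b\<close> and splits the edges at \<open>a\<close> and \<open>b\<close> into one path \<open>P\<close> and trails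
  \<open>x\<^sub>1 a x\<^sub>2\<close> and \<open>y\<^sub>1 b y\<^sub>2\<close> (or a single one, possibly \<open>s a b t\<close>) whose ends are not adjacent.
  Delete \<open>a\<close> and \<open>b\<close> and join the ends of each trail by a new edge. A decomposition of the
  smaller graph into \<open>(n - 2)/2\<close> paths yields one of the old graph: subdivide the new edges by \<open>a\<close> and \<open>b\<close>, and add \<open>P\<close>. So the smaller
  graph has an exceptional set, which must contain a new edge or a former neighbour of \<open>a\<close> or \<open>b\<close>.
  Choosing \<open>a\<close>, \<open>b\<close> and \<open>P\<close> suitably, this excludes in turn \<open>K\<^sub>5\<^sup>-\<close>, \<open>K\<^sub>4\<close>, triangles with two
  vertices of degree 2, diamonds (\<open>K\<^sub>4\<close> minus an edge), non-adjacent neighbours of a vertex of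
  degree 2, triangles, and finally edges, up to a few graphs on at most seven vertices that are
  decomposed explicitly.
\<close>

subsection \<open>Decomposing edge sets into paths\<close>

text \<open>The exceptional graphs are those that fail by counting. A path has at most n - 1 edges,
  so n div 2 paths cover at most (n div 2)(n - 1) edges. With maximum degree 4 this falls short only
  for n = 3 with 3 edges and for n = 5 with 9 or 10 edges. Forbidding closed vertex sets, instead of
  assuming connectedness, lets the induction pass through disconnected graphs, which a deletion may
  produce. A new edge at a vertex replaces a lost edge to \<open>a\<close> or \<open>b\<close>, so
  the degree bound survives; the only obstacle is the exceptional set \<open>T\<close> that new
  edges may create. Each reduction is chosen so that \<open>T\<close> is too poor in edges, too
  large, or determines the whole graph. The order of the exclusions matters. Once
  \<open>K\<^sub>5\<^sup>-\<close> is gone, a five-element \<open>T\<close> needs a new edge; once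
  diamonds are gone, its new edges cannot all meet in one vertex, because the other four vertices
  would span a diamond. Then mostly triangles \<open>T\<close> remain, and these tend to contain a
  vertex of degree 2 that can be suppressed.\<close>

definition edge :: "'a \<Rightarrow> 'a \<Rightarrow> ('a \<times> 'a) set" where
  "edge x y = {(x, y), (y, x)}"

lemma in_edge [simp]: "(p, q) \<in> edge x y \<longleftrightarrow> p = x \<and> q = y \<or> p = y \<and> q = x"
  by (auto simp: edge_def)

lemma edge_commute: "edge x y = edge y x"
  by (auto simp: edge_def)

lemma edge_disjoint [simp]:
  "edge x y \<inter> edge u v = {} \<longleftrightarrow> (x, y) \<noteq> (u, v) \<and> (x, y) \<noteq> (v, u)"
  by (auto simp: edge_def)

lemma edge_Image: "edge x y `` {z} = (if z = x then {y} else {}) \<union> (if z = y then {x} else {})"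
  by (auto split: if_splits)

lemma edge_sub_iff [simp]: "edge x y \<subseteq> A \<longleftrightarrow> (x, y) \<in> A \<and> (y, x) \<in> A"
  by (auto simp: edge_def)

lemma Domain_edge [simp]: "Domain (edge x y) = {x, y}"
  by (auto simp: edge_def)

lemma Field_edge [simp]: "Field (edge x y) = {x, y}"
  by (auto simp: edge_def Field_def)

fun path_edges :: "'a list \<Rightarrow> ('a \<times> 'a) set" where
  "path_edges (x # y # p) = edge x y \<union> path_edges (y # p)"
| "path_edges _ = {}"

text \<open>The base case admits every \<open>k\<close>, so \<open>k\<close> is an upper bound for
  the number of paths. A list without edges may be added as well.\<close>

inductive decomposable :: "('a \<times> 'a) set \<Rightarrow> nat \<Rightarrow> bool" where
  empty: "decomposable {} k"
| add_path: "decomposable E k \<Longrightarrow> distinct p \<Longrightarrow> path_edges p \<inter> E = {} \<Longrightarrow>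
    decomposable (E \<union> path_edges p) (Suc k)"

lemma path_edges_append_Cons:
  "path_edges (p @ x # q) = path_edges (p @ [x]) \<union> path_edges (x # q)"
  by (induction p rule: path_edges.induct) auto

lemma path_edges_rev: "path_edges (rev p) = path_edges p"
proof (induction p rule: path_edges.induct)
  case (1 x y p)
  then show ?case
    using path_edges_append_Cons[of "rev p" y "[x]"] by auto
qed auto

lemma path_edges_subset: "path_edges p \<subseteq> set p \<times> set p"
  by (induction p rule: path_edges.induct) auto

lemma path_edges_in: "(x, y) \<in> path_edges p \<Longrightarrow> x \<in> set p \<and> y \<in> set p"
  using path_edges_subset by blast

text \<open>A path with an edge has no isolated vertex. Hence a vertex that meets no edge of a
  decomposed set lies on none of its non-trivial paths and is free to be inserted into one.\<close>

lemma path_vertex_covered: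
  "x \<in> set p \<Longrightarrow> (u, v) \<in> path_edges p \<Longrightarrow> \<exists>y. (x, y) \<in> path_edges p"
proof (induction p arbitrary: u v x rule: path_edges.induct)
  case (1 a b p)
  show ?case
  proof (cases "x = a \<or> x = b")
    case False
    then have x: "x \<in> set (b # p)" "x \<in> set p" using 1 by auto
    then obtain c q where "p = c # q" by (cases p) auto
    then have "(b, c) \<in> path_edges (b # p)" by simp
    then show ?thesis using 1(1)[OF x(1)] by auto
  qed auto
qed auto

lemma path_edge_split:
  "(x, y) \<in> path_edges p \<Longrightarrow> \<exists>q r. p = q @ x # y # r \<or> rev p = q @ x # y # r"
proof (induction p rule: path_edges.induct)
  case (1 a b p)
  consider "x = a \<and> y = b" | "x = b \<and> y = a" | "(x, y) \<in> path_edges (b # p)" using 1 by auto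
  then show ?case
  proof cases
    case 1
    then show ?thesis by (auto intro: exI[of _ "[]"])
  next
    case 2
    then have "rev (a # b # p) = rev p @ x # y # []" by simp
    then show ?thesis by blast
  next
    case 3
    then obtain q r where "b # p = q @ x # y # r \<or> rev (b # p) = q @ x # y # r"
      using 1(1) by blast
    then have "a # b # p = (a # q) @ x # y # r \<or> rev (a # b # p) = q @ x # y # (r @ [a])" by auto
    then show ?thesis by blast
  qed
qed auto

lemma decomposable_mono: "decomposable E k \<Longrightarrow> k \<le> l \<Longrightarrow> decomposable E l"
proof (induction arbitrary: l rule: decomposable.induct)
  case (add_path E k p)
  then obtain l' where "l = Suc l'" "k \<le> l'" by (cases l) auto
  then show ?case using add_path by (simp add: decomposable.add_path)
qed (rule decomposable.empty)

lemma decomposable_Un: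
  assumes "decomposable E k" "decomposable F l" "E \<inter> F = {}"
  shows "decomposable (E \<union> F) (k + l)"
  using assms(2,3)
proof (induction rule: decomposable.induct)
  case (empty l)
  then show ?case using assms(1) by (simp add: decomposable_mono)
next
  case (add_path F l p)
  then have "decomposable ((E \<union> F) \<union> path_edges p) (Suc (k + l))"
    by (intro decomposable.add_path) auto
  then show ?case by (simp add: Un_assoc)
qed

lemma decomposable_path: "distinct p \<Longrightarrow> decomposable (path_edges p) 1"
  using decomposable.add_path[OF decomposable.empty, of p 0] by simp

lemma decomposable_add_path:
  "decomposable E k \<Longrightarrow> distinct p \<Longrightarrow> path_edges p \<inter> E = {} \<Longrightarrow> E' = E \<union> path_edges p \<Longrightarrow>
    decomposable E' (Suc k)"
  by (simp add: decomposable.add_path)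

lemma decomposable_two_paths:
  "distinct p \<Longrightarrow> distinct q \<Longrightarrow> path_edges p \<inter> path_edges q = {} \<Longrightarrow>
    E = path_edges p \<union> path_edges q \<Longrightarrow> decomposable E 2"
  using decomposable_Un[OF decomposable_path decomposable_path, of p q]
    by (simp add: numeral_2_eq_2)

lemma decomposable_three_paths:
  assumes "distinct p" "distinct q" "distinct r"
    and "path_edges p \<inter> path_edges q = {}" "path_edges p \<inter> path_edges r = {}"
      "path_edges q \<inter> path_edges r = {}"
    and "E = path_edges p \<union> path_edges q \<union> path_edges r"
  shows "decomposable E 3"
  using decomposable.add_path[OF decomposable_two_paths[OF assms(1,2,4) refl] assms(3)] assms(4-)
  by (simp add: eval_nat_numeral Int_Un_distrib Int_commute)

text \<open>The order of the paths is irrelevant, so the one that carries \<open>e\<close> can be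
  taken to be the last one added.\<close>

lemma decomposable_extract_edge:
  "decomposable E k \<Longrightarrow> e \<in> E \<Longrightarrow>
    \<exists>p E' k'. k = Suc k' \<and> decomposable E' k' \<and> distinct p \<and> path_edges p \<inter> E' = {} \<and>
      E = E' \<union> path_edges p \<and> e \<in> path_edges p"
proof (induction rule: decomposable.induct)
  case (add_path E k p)
  show ?case
  proof (cases "e \<in> path_edges p")
    case True
    then show ?thesis using add_path by blast
  next
    case False
    then obtain q E' k' where *: "k = Suc k'" "decomposable E' k'" "distinct q"
      "path_edges q \<inter> E' = {}"
        "E = E' \<union> path_edges q" "e \<in> path_edges q"
      using add_path by blast
    have "decomposable (E' \<union> path_edges p) (Suc k')"
      using * add_path by (intro decomposable.add_path) auto
    moreover have "path_edges q \<inter> (E' \<union> path_edges p) = {}"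
      "E \<union> path_edges p = (E' \<union> path_edges p) \<union> path_edges q"
      using * add_path by auto
    ultimately show ?thesis using * by blast
  qed
qed simp

lemma decomposable_extract_vertex:
  assumes "decomposable E k" "(y, z) \<in> E"
  obtains p q E' k' where "k = Suc k'" "decomposable E' k'" "distinct (p @ y # q)"
    "path_edges (p @ y # q) \<inter> E' = {}" "E = E' \<union> path_edges (p @ y # q)"
    "set (p @ y # q) \<subseteq> Domain E"
proof -
  obtain r E' k' where *: "k = Suc k'" "decomposable E' k'" "distinct r" "path_edges r \<inter> E' = {}"
    "E = E' \<union> path_edges r" "(y, z) \<in> path_edges r"
    using decomposable_extract_edge[OF assms] by blast
  then obtain p q where "r = p @ y # q" using path_edges_in[of y z r] by (meson split_list)
  moreover have "set r \<subseteq> Domain E" using path_vertex_covered[OF _ *(6)] *(5) by blast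
  ultimately show thesis using * that by blast
qed

text \<open>The path through \<open>xy\<close> is rerouted along \<open>x a y\<close>. It stays
  simple because \<open>a\<close> meets no edge of \<open>E\<close>, and the number of paths does
  not change. This undoes a new edge of a reduced graph.\<close>

lemma decomposable_subdivide:
  assumes "decomposable (E \<union> edge x y) k" "(x, y) \<notin> E" "(y, x) \<notin> E" "x \<noteq> y"
    and "a \<notin> Field E" "a \<noteq> x" "a \<noteq> y"
  shows "decomposable (E \<union> edge x a \<union> edge a y) k"
proof -
  obtain p E' k' where *: "k = Suc k'" "decomposable E' k'" "distinct p" "path_edges p \<inter> E' = {}"
      "E \<union> edge x y = E' \<union> path_edges p" "(x, y) \<in> path_edges p"
    using decomposable_extract_edge[OF assms(1), of "(x, y)"] by auto
  have a: "a \<notin> set p"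
  proof
    assume "a \<in> set p"
    then obtain z where "(a, z) \<in> path_edges p" using path_vertex_covered[OF _ *(6)] by blast
    then have "(a, z) \<in> E \<union> edge x y" unfolding *(5) by simp
    then show False using assms by (auto simp: Field_def)
  qed
  obtain q r where "p = q @ x # y # r \<or> rev p = q @ x # y # r" using path_edge_split[OF *(6)]
    by blast
  then obtain p' where p': "p' = q @ x # y # r" "distinct p'" "path_edges p' = path_edges p"
    "a \<notin> set p'"
    using *(3) a path_edges_rev by (metis distinct_rev set_rev)
  have 1: "path_edges p = path_edges (q @ [x]) \<union> path_edges (y # r) \<union> edge x y"
    using p' path_edges_append_Cons[of q x "y # r"] by auto
  have 2: "path_edges (q @ x # a # y # r)
      = path_edges (q @ [x]) \<union> path_edges (y # r) \<union> (edge x a \<union> edge a y)"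
    using path_edges_append_Cons[of q x "a # y # r"] by auto
  have 3: "edge x y \<inter> (path_edges (q @ [x]) \<union> path_edges (y # r)) = {}"
    using p' path_edges_in[of x y "q @ [x]"] path_edges_in[of y x "q @ [x]"]
      path_edges_in[of x y "y # r"] path_edges_in[of y x "y # r"] by auto
  have "E' \<subseteq> E \<union> edge x y" using *(5) by blast
  then have a': "a \<notin> Field E'" using assms(5-) by (auto simp: Field_def)
  define W where "W = path_edges (q @ [x]) \<union> path_edges (y # r)"
  have W: "path_edges p = W \<union> edge x y" "edge x y \<inter> W = {}"
    "path_edges (q @ x # a # y # r) = W \<union> (edge x a \<union> edge a y)"
    using 1 2 3 by (simp_all add: W_def)
  have "E = E' \<union> W"
  proof -
    have "E = (E \<union> edge x y) - edge x y" using assms(2,3) by auto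
    also have "\<dots> = (E' \<union> (W \<union> edge x y)) - edge x y" using *(5) W(1) by simp
    also have "\<dots> = E' \<union> W" using *(4) W by auto
    finally show ?thesis .
  qed
  then have "E \<union> edge x a \<union> edge a y = E' \<union> path_edges (q @ x # a # y # r)"
    using W(3) by (simp add: Un_assoc)
  moreover have "path_edges (q @ x # a # y # r) \<inter> E' = {}"
    unfolding W(3) using *(4) W(1) a' by (auto intro: FieldI1 FieldI2)
  moreover have "distinct (q @ x # a # y # r)" using p' by auto
  ultimately show ?thesis using *(1,2) decomposable_add_path by blast
qed

lemma path_edges_irrefl: "distinct p \<Longrightarrow> (x, x) \<notin> path_edges p"
  by (induction p rule: path_edges.induct) auto

lemma path_edges_disjoint:
  assumes "distinct (p @ x # q)"
  shows "path_edges (p @ [x]) \<inter> path_edges (x # q) = {}"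
proof -
  have False if "(u, v) \<in> path_edges (p @ [x])" "(u, v) \<in> path_edges (x # q)" for u v
  proof -
    have "u = x" "v = x" using that[THEN path_edges_in] assms by auto
    then show False using that(2) path_edges_irrefl[of "x # q" x] assms by auto
  qed
  then show ?thesis by auto
qed

lemma path_edges_append_Cons_rev:
  "path_edges (rev q @ y # r) = path_edges (y # q) \<union> path_edges (y # r)"
  using path_edges_append_Cons[of "rev q" y r] path_edges_rev[of "y # q"] by simp

text \<open>The path through \<open>y\<close> is exchanged for \<open>r1 @ y # p\<close> and
  \<open>rev q @ y # r2\<close>. It is not counted in \<open>k\<close>, hence \<open>k + 2\<close>:
  the net cost is one path.\<close>

lemma decomposable_split_aux:
  assumes dec: "decomposable E k" and r: "distinct (r1 @ y # r2)"
    "path_edges (r1 @ y # r2) \<inter> E = {}"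
      "set (r1 @ y # r2) \<subseteq> D"
    and p: "distinct (y # p)" "path_edges (y # p) \<inter> (E \<union> path_edges (r1 @ y # r2)) = {}"
      "set p \<inter> D \<subseteq> {x}" "x \<notin> set r1"
    and q: "distinct (y # q)" "path_edges (y # q) \<inter> (E \<union> path_edges (r1 @ y # r2)) = {}"
      "set q \<inter> D = {}" "path_edges (y # p) \<inter> path_edges (y # q) = {}"
  shows
    "decomposable (E \<union> path_edges (r1 @ y # r2) \<union> path_edges (y # p) \<union> path_edges (y # q)) (k + 2)"
proof -
  define A B P Q where "A = path_edges (r1 @ [y])" "B = path_edges (y # r2)"
    "P = path_edges (y # p)" "Q = path_edges (y # q)"
  have AB: "path_edges (r1 @ y # r2) = A \<union> B" "A \<inter> B = {}"
    using path_edges_append_Cons[of r1 y r2] path_edges_disjoint[OF r(1)]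
      by (simp_all add: A_B_P_Q_def)
  have AP: "path_edges (r1 @ y # p) = A \<union> P"
    using path_edges_append_Cons[of r1 y p] by (simp add: A_B_P_Q_def)
  have QB: "path_edges (rev q @ y # r2) = Q \<union> B"
    by (simp add: A_B_P_Q_def path_edges_append_Cons_rev)
  have d: "(A \<union> B) \<inter> E = {}" "P \<inter> (E \<union> (A \<union> B)) = {}" "Q \<inter> (E \<union> (A \<union> B)) = {}" "P \<inter> Q = {}"
    using r(2) p(2) q(2,4) unfolding AB(1) A_B_P_Q_def(3,4) by blast+
  have "decomposable (E \<union> path_edges (r1 @ y # p)) (Suc k)"
  proof (rule decomposable.add_path[OF dec])
    show "distinct (r1 @ y # p)" using r(1,3) p by auto
    show "path_edges (r1 @ y # p) \<inter> E = {}" unfolding AP using d by blast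
  qed
  then have "decomposable (E \<union> path_edges (r1 @ y # p) \<union> path_edges (rev q @ y # r2)) (Suc (Suc k))"
  proof (rule decomposable.add_path)
    show "distinct (rev q @ y # r2)" using r(1,3) q by auto
    show "path_edges (rev q @ y # r2) \<inter> (E \<union> path_edges (r1 @ y # p)) = {}"
      unfolding AP QB using d AB(2) by blast
  qed
  moreover have "E \<union> path_edges (r1 @ y # p) \<union> path_edges (rev q @ y # r2) =
      E \<union> path_edges (r1 @ y # r2) \<union> path_edges (y # p) \<union> path_edges (y # q)"
    unfolding AP QB AB(1) A_B_P_Q_def(3,4)[symmetric] by blast
  ultimately show ?thesis by simp
qed

text \<open>A path of the decomposition through \<open>y\<close> is cut at \<open>y\<close>, and both halves are continued along new
  edges. The continuation \<open>p\<close> may meet the old graph in \<open>x\<close>, as at most one of the halves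
  contains \<open>x\<close>.\<close>

lemma decomposable_split:
  assumes dec: "decomposable E k" "(y, z) \<in> E"
    and p: "distinct (y # p)" "path_edges (y # p) \<inter> E = {}" "set p \<inter> Domain E \<subseteq> {x}"
    and q: "distinct (y # q)" "path_edges (y # q) \<inter> E = {}" "set q \<inter> Domain E = {}"
    and pq: "path_edges (y # p) \<inter> path_edges (y # q) = {}"
  shows "decomposable (E \<union> path_edges (y # p) \<union> path_edges (y # q)) (Suc k)"
proof -
  obtain r1 r2 E' k' where r: "k = Suc k'" "decomposable E' k'" "distinct (r1 @ y # r2)"
      "path_edges (r1 @ y # r2) \<inter> E' = {}" "E = E' \<union> path_edges (r1 @ y # r2)"
      "set (r1 @ y # r2) \<subseteq> Domain E"
    by (rule decomposable_extract_vertex[OF dec])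
  have aux: ?thesis if s: "distinct (s1 @ y # s2)"
    "path_edges (s1 @ y # s2) = path_edges (r1 @ y # r2)"
      "set (s1 @ y # s2) = set (r1 @ y # r2)" "x \<notin> set s1" for s1 s2
  proof -
    have
      "decomposable (E' \<union> path_edges (s1 @ y # s2) \<union> path_edges (y # p) \<union> path_edges (y # q)) (k' + 2)"
      by (rule decomposable_split_aux[OF r(2) s(1) _ _ p(1) _ p(3) s(4) q(1) _ q(3) pq])
        (use r(4-6) p(2) q(2) s(2,3) in auto)
    then show ?thesis using r(1,5) s(2) by simp
  qed
  show ?thesis
  proof (cases "x \<in> set r1")
    case False
    then show ?thesis using aux[of r1 r2] r(3) by simp
  next
    case True
    \<comment> \<open>Reversing the path swaps its halves, so \<open>x\<close> moves to the half
      that \<open>q\<close> continues, and \<open>q\<close> avoids the old graph.\<close>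
    have "path_edges (rev r2 @ y # rev r1) = path_edges (r1 @ y # r2)"
      using path_edges_rev[of "r1 @ y # r2"] by simp
    moreover have "x \<notin> set (rev r2)" "distinct (rev r2 @ y # rev r1)"
      "set (rev r2 @ y # rev r1) = set (r1 @ y # r2)"
      using True r(3) by auto
    ultimately show ?thesis using aux by blast
  qed
qed

subsection \<open>Exceptional vertex sets\<close>

text \<open>For \<open>x = y\<close> the set is complete.\<close>

definition near_complete :: "('a \<times> 'a) set \<Rightarrow> 'a set \<Rightarrow> bool" where
  "near_complete E T \<longleftrightarrow> (\<exists>x y. T \<times> T - Id - edge x y \<subseteq> E)"

text \<open>Only the relation enters. Each element of \<open>T\<close> has at least two neighbours,
  which places \<open>T\<close> inside the vertex set of a finite graph with edge relation
  \<open>E\<close>.\<close>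

definition exceptional :: "('a \<times> 'a) set \<Rightarrow> 'a set \<Rightarrow> bool" where
  "exceptional E T \<longleftrightarrow> E `` T \<subseteq> T \<and>
    (card T = 3 \<and> T \<times> T - Id \<subseteq> E \<or> card T = 5 \<and> near_complete E T)"

definition graph4 :: "'a set \<Rightarrow> ('a \<times> 'a) set \<Rightarrow> bool" where
  "graph4 V E \<longleftrightarrow> finite V \<and> E \<subseteq> V \<times> V \<and> sym E \<and> irrefl E \<and> (\<forall>x. card (E `` {x}) \<le> 4)"

lemma card_3_eq: "card T = 3 \<Longrightarrow> {x, y, z} \<subseteq> T \<Longrightarrow> distinct [x, y, z] \<Longrightarrow> T = {x, y, z}"
  using card_subset_eq[of T "{x, y, z}"] card_gt_0_iff[of T] by simp

lemma card_3_extend2: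
  assumes "card T = 3" "{x, y} \<subseteq> T" "x \<noteq> y"
  obtains z where "T = {x, y, z}" "z \<noteq> x" "z \<noteq> y"
proof -
  have "card (T - {x, y}) = 1" using assms card_gt_0_iff[of T] by (simp add: card_Diff_subset)
  then obtain z where "T - {x, y} = {z}" by (rule card_1_singletonE)
  then have "T = {x, y, z}" "z \<noteq> x" "z \<noteq> y" using assms(2) by blast+
  then show thesis by (rule that)
qed

lemma card_3_extend1:
  assumes "card T = 3" "x \<in> T"
  obtains y z where "T = {x, y, z}" "distinct [x, y, z]"
proof -
  have "card (T - {x}) = 2" using assms card_gt_0_iff[of T] by (simp add: card_Diff_subset)
  then obtain y z where *: "T - {x} = {y, z}" "y \<noteq> z" by (auto simp: card_2_iff)
  then have "T = {x, y, z}" using assms(2) by blast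
  moreover have "distinct [x, y, z]" using * by auto
  ultimately show thesis by (rule that)
qed

lemma card_5_extend3:
  assumes "card T = 5" "{x, y, z} \<subseteq> T" "distinct [x, y, z]"
  obtains p q where "T = {x, y, z, p, q}" "distinct [x, y, z, p, q]"
proof -
  have "card (T - {x, y, z}) = 2" using assms card_gt_0_iff[of T] by (simp add: card_Diff_subset)
  then obtain p q where *: "T - {x, y, z} = {p, q}" "p \<noteq> q" by (auto simp: card_2_iff)
  then have "T = {x, y, z, p, q}" using assms(2) by blast
  moreover have "distinct [x, y, z, p, q]" using * assms(3) by auto
  ultimately show thesis by (rule that)
qed

lemma near_complete_missing:
  assumes "near_complete E T" "t \<in> T"
  obtains m where "T - {t} - {m} \<subseteq> E `` {t}"
proof -
  obtain x y where xy: "T \<times> T - Id - edge x y \<subseteq> E" using assms(1) by (auto simp: near_complete_def)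
  \<comment> \<open>If \<open>t\<close> is an end of the missing edge, \<open>m\<close> is the other
    end; otherwise any value of \<open>m\<close> will do.\<close>
  show thesis
    by (rule that[of "if t = x then y else x"]) (use xy assms(2) in auto)
qed

lemma near_complete_unique_missing:
  assumes "near_complete E T" "{p, q, r, s} \<subseteq> T" "p \<noteq> q" "r \<noteq> s" "(p, q) \<notin> E" "(r, s) \<notin> E"
  shows "{p, q} = {r, s}"
proof -
  obtain x y where xy: "T \<times> T - Id - edge x y \<subseteq> E" using assms(1) by (auto simp: near_complete_def)
  have "p \<in> T" "q \<in> T" "r \<in> T" "s \<in> T" using assms(2) by simp_all
  then have "(p, q) \<in> edge x y" "(r, s) \<in> edge x y" using xy assms(3-) by blast+
  then show ?thesis by auto
qed

lemma exceptional_degree_2: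
  assumes "exceptional E T" "t \<in> T" "finite (E `` {t})"
  shows "2 \<le> card (E `` {t})"
proof (cases "card T = 3")
  case True
  then have "T - {t} \<subseteq> E `` {t}" using assms by (auto simp: exceptional_def)
  from card_mono[OF assms(3) this] show ?thesis using True assms(2) by simp
next
  case False
  then have T: "card T = 5" "near_complete E T" using assms(1) by (auto simp: exceptional_def)
  obtain m where "T - {t} - {m} \<subseteq> E `` {t}" using near_complete_missing[OF T(2) assms(2)] .
  from card_mono[OF assms(3) this] show ?thesis using T(1) assms(2)
    by (cases "m \<in> T - {t}") (auto simp: card_Diff_singleton_if)
qed

lemma exceptional_degree_3:
  assumes "exceptional E T" "t \<in> T" "card T = 5" "finite (E `` {t})"
  shows "3 \<le> card (E `` {t})"
proof -
  have T: "near_complete E T" using assms by (auto simp: exceptional_def)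
  obtain m where "T - {t} - {m} \<subseteq> E `` {t}" using near_complete_missing[OF T assms(2)] .
  from card_mono[OF assms(4) this] show ?thesis using assms(2,3)
    by (cases "m \<in> T - {t}") (auto simp: card_Diff_singleton_if)
qed

lemma exceptional_card: "exceptional E T \<Longrightarrow> card T = 3 \<or> card T = 5"
  by (auto simp: exceptional_def)

lemma exceptional_closed: "exceptional E T \<Longrightarrow> (t, s) \<in> E \<Longrightarrow> t \<in> T \<Longrightarrow> s \<in> T"
  by (auto simp: exceptional_def)

lemma exceptional_3: "exceptional E T \<Longrightarrow> card T = 3 \<Longrightarrow> p \<in> T \<Longrightarrow> q \<in> T \<Longrightarrow> p \<noteq> q \<Longrightarrow> (p, q) \<in> E"
  by (auto simp: exceptional_def)

lemma exceptional_5: "exceptional E T \<Longrightarrow> card T = 5 \<Longrightarrow> near_complete E T"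
  by (auto simp: exceptional_def)

text \<open>In a set of five, every vertex keeps at least three neighbours, so a vertex with at most
  two forces a triangle. Taking \<open>x\<close> and \<open>y\<close> equal turns the last
  conclusion into a contradiction for vertices of degree at most 1.\<close>

lemma exceptional_degree_le_2:
  assumes "exceptional E T" "t \<in> T" "E `` {t} \<subseteq> {x, y}"
  shows "card T = 3" "E `` {t} = {x, y}" "x \<noteq> y"
proof -
  have fin: "finite (E `` {t})" using assms(3) by (rule finite_subset) simp
  have "card (E `` {t}) \<le> card {x, y}" using assms(3) by (intro card_mono) auto
  also have "\<dots> \<le> 2" by (simp add: card_insert_if)
  finally have le: "card (E `` {t}) \<le> 2" .
  then show "card T = 3"
    using exceptional_degree_3[OF assms(1,2) _ fin] exceptional_card[OF assms(1)] by force
  have "2 \<le> card (E `` {t})" by (rule exceptional_degree_2[OF assms(1,2) fin])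
  moreover from this have "card {x, y} = 2"
    using card_mono[OF _ assms(3)] by (simp add: card_insert_if split: if_splits)
  ultimately show "E `` {t} = {x, y}" "x \<noteq> y"
    using le card_subset_eq[OF _ assms(3)] by (auto simp: card_insert_if split: if_splits)
qed

lemma card_5_extend4:
  assumes "card T = 5" "{x, y, z, w} \<subseteq> T" "distinct [x, y, z, w]"
  obtains q where "T = {x, y, z, w, q}" "distinct [x, y, z, w, q]"
proof -
  have "card (T - {x, y, z, w}) = 1" using assms card_gt_0_iff[of T] by (simp add: card_Diff_subset)
  then obtain q where *: "T - {x, y, z, w} = {q}" by (rule card_1_singletonE)
  then have "T = {x, y, z, w, q}" using assms(2) by blast
  moreover have "distinct [x, y, z, w, q]" using * assms(3) by auto
  ultimately show thesis by (rule that)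
qed

text \<open>Four other vertices face at most three neighbours. As only one pair is missing, two
  vertices of this kind in the same set must miss each other.\<close>

lemma exceptional_5_missing:
  assumes "exceptional E T" "card T = 5" "t \<in> T" "E `` {t} \<subseteq> {x, y, z}"
  obtains m where "m \<in> T" "m \<noteq> t" "(t, m) \<notin> E"
proof (rule ccontr)
  assume "\<not> thesis"
  then have "T - {t} \<subseteq> {x, y, z}" using assms(4) that by blast
  then have "card (T - {t}) \<le> card {x, y, z}" by (intro card_mono) auto
  also have "\<dots> \<le> 3" by (simp add: card_insert_if)
  finally show False using assms(2,3) by simp
qed

lemma exceptional_4_imp_5:
  assumes "exceptional E T" "{x, y, z, w} \<subseteq> T" "distinct [x, y, z, w]"
  shows "card T = 5"
proof -
  have "finite T" using exceptional_card[OF assms(1)] by (auto intro: card_ge_0_finite)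
  from card_mono[OF this assms(2)] have "4 \<le> card T" using assms(3) by simp
  then show ?thesis using exceptional_card[OF assms(1)] by linarith
qed

lemma exceptional_not_6:
  assumes "exceptional E T" "{x, y, z, w, p, q} \<subseteq> T" "distinct [x, y, z, w, p, q]"
  shows False
proof -
  have "finite T" using exceptional_card[OF assms(1)] by (auto intro: card_ge_0_finite)
  from card_mono[OF this assms(2)] have "6 \<le> card T" using assms(3) by simp
  then show ?thesis using exceptional_card[OF assms(1)] by linarith
qed

text \<open>Serves in two ways: to identify two missing pairs with each other, and, once a missing
  pair is known, to obtain all other adjacencies in \<open>T\<close>.\<close>

lemma exceptional_one_missing:
  assumes "exceptional E T" "card T = 5" "{p, q, r, s} \<subseteq> T" "p \<noteq> q" "r \<noteq> s" "{p, q} \<noteq> {r, s}"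
  shows "(p, q) \<in> E \<or> (r, s) \<in> E"
  using near_complete_unique_missing[OF exceptional_5[OF assms(1,2)] assms(3,4,5)] assms(6) by blast

subsection \<open>Reductions of a minimal counterexample\<close>

definition star :: "'a \<Rightarrow> 'a set \<Rightarrow> ('a \<times> 'a) set" where
  "star a A = {a} \<times> A \<union> A \<times> {a}"

lemma star_simps [simp]: "star a {} = {}" "star a (insert b A) = edge a b \<union> star a A"
  by (auto simp: star_def edge_def)

text \<open>\<open>smaller\<close> is the induction hypothesis and covers disconnected graphs, as
  the reduced graphs may be disconnected. \<open>connected\<close> is phrased through closed sets,
  the form in which small configurations are finished off.\<close>

locale min_counterexample =
  fixes V :: "'a set" and E :: "('a \<times> 'a) set"
  assumes graph4: "graph4 V E"
    and connected: "W \<subseteq> V \<Longrightarrow> W \<noteq> {} \<Longrightarrow> E `` W \<subseteq> W \<Longrightarrow> W = V"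
    and not_exceptional: "\<not> exceptional E T"
    and smaller: "\<And>(V' :: 'a set) E'. card V' < card V \<Longrightarrow> graph4 V' E' \<Longrightarrow> (\<And>T. \<not> exceptional E' T) \<Longrightarrow>
      decomposable E' (card V' div 2)"
    and not_decomposable: "\<not> decomposable E (card V div 2)"
begin

definition N :: "'a \<Rightarrow> 'a set" where
  "N x = E `` {x}"

lemma mem_E: "(x, y) \<in> E \<longleftrightarrow> y \<in> N x"
  by (simp add: N_def)

definition del :: "'a set \<Rightarrow> ('a \<times> 'a) set" where
  "del S = {(x, y) \<in> E. x \<notin> S \<and> y \<notin> S}"

lemma finite_V: "finite V" and E_V: "E \<subseteq> V \<times> V" and degree: "card (N x) \<le> 4"
  using graph4 by (auto simp: graph4_def N_def)

lemma E_sym: "(x, y) \<in> E \<Longrightarrow> (y, x) \<in> E"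
  using graph4 by (auto simp: graph4_def dest: symD)

lemma E_irrefl [simp]: "(x, x) \<notin> E"
  using graph4 by (auto simp: graph4_def irrefl_def)

lemma in_V: "(x, y) \<in> E \<Longrightarrow> x \<in> V \<and> y \<in> V"
  using E_V by auto

lemma finite_N [simp]: "finite (N x)"
  using finite_subset[OF _ finite_V, of "N x"] E_V by (auto simp: N_def)

lemma N_sym: "y \<in> N x \<Longrightarrow> x \<in> N y"
  using E_sym by (simp add: N_def)

lemma N_irrefl [simp]: "x \<notin> N x"
  by (simp add: N_def)

lemma N_V: "y \<in> N x \<Longrightarrow> x \<in> V \<and> y \<in> V"
  using in_V by (simp add: N_def)

lemma N_eq4: "{p, q, r, s} \<subseteq> N x \<Longrightarrow> distinct [p, q, r, s] \<Longrightarrow> N x = {p, q, r, s}"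
  by (rule card_seteq[symmetric]) (use degree[of x] in auto)

lemma N_cases3:
  assumes "{p, q, r} \<subseteq> N x" "distinct [p, q, r]"
  obtains "N x = {p, q, r}" | s where "N x = {p, q, r, s}" "distinct [p, q, r, s]"
proof (cases "N x = {p, q, r}")
  case False
  then obtain s where "s \<in> N x" "s \<notin> {p, q, r}" using assms by blast
  then show thesis using that N_eq4[of p q r s x] assms by auto
qed

lemma N_cases2:
  assumes "{p, q} \<subseteq> N x" "distinct [p, q]"
  obtains "N x = {p, q}" | r where "N x = {p, q, r}" "distinct [p, q, r]"
  | r s where "N x = {p, q, r, s}" "distinct [p, q, r, s]"
proof (cases "N x = {p, q}")
  case False
  then obtain r where r: "r \<in> N x" "r \<notin> {p, q}" using assms by blast
  show thesis by (rule N_cases3[of p q r x]) (use that r assms in auto)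
qed

lemma N_cases1:
  assumes "p \<in> N x"
  obtains "N x = {p}" | q where "N x = {p, q}" "distinct [p, q]"
  | q r where "N x = {p, q, r}" "distinct [p, q, r]"
  | q r s where "N x = {p, q, r, s}" "distinct [p, q, r, s]"
proof (cases "N x = {p}")
  case False
  then obtain q where q: "q \<in> N x" "q \<noteq> p" using assms by blast
  show thesis by (rule N_cases2[of p q x]) (use that q assms in auto)
qed

lemma closed_eq_V: "W \<noteq> {} \<Longrightarrow> W \<subseteq> V \<Longrightarrow> (\<And>x. x \<in> W \<Longrightarrow> N x \<subseteq> W) \<Longrightarrow> V = W"
  using connected[of W] by (auto simp: N_def)

text \<open>By connectedness a closed \<open>W\<close> is the whole vertex set, so an explicit
  decomposition of the edges at \<open>W\<close> contradicts \<open>not_decomposable\<close>. All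
  finite leftover graphs are discarded this way.\<close>

lemma closed_small:
  assumes W: "W \<noteq> {}" "W \<subseteq> V" "\<And>x. x \<in> W \<Longrightarrow> N x \<subseteq> W"
    and dec: "decomposable (\<Union>x\<in>W. star x (N x)) (card W div 2)"
  shows False
proof -
  have "V = W" by (rule closed_eq_V[OF W])
  moreover have "E = (\<Union>x\<in>V. star x (N x))"
    using N_sym E_V by (auto simp: star_def N_def)
  ultimately show False using dec not_decomposable by simp
qed

lemma E_split2:
  assumes "N a = A" "N b = B"
  shows "E = del {a, b} \<union> star a A \<union> star b B"
  using N_sym assms by (auto simp: del_def mem_E star_def)

lemma del_notin [simp]: "a \<in> S \<Longrightarrow> (a, x) \<notin> del S" "a \<in> S \<Longrightarrow> (x, a) \<notin> del S"
  by (auto simp: del_def)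

lemma del_sub: "del S \<subseteq> E"
  by (auto simp: del_def)

lemma del_notin_E: "(x, y) \<notin> E \<Longrightarrow> (x, y) \<notin> del S"
  using del_sub by blast

lemma Field_del [simp]: "x \<in> S \<Longrightarrow> x \<notin> Field (del S)"
  by (auto simp: del_def Field_def)

lemma edge_del: "x \<in> S \<or> y \<in> S \<Longrightarrow> edge x y \<inter> del S = {}"
  by (auto simp: edge_def)

text \<open>If the smaller graph had no exceptional set, its decomposition would lift to one that
  the counterexample does not admit. \<open>deg\<close> charges each new edge at \<open>x\<close> to
  a lost edge from \<open>x\<close> to \<open>S\<close>, so the degree bound persists. If
  \<open>T\<close> met neither a new edge nor a neighbour of \<open>S\<close>, it would be
  exceptional in \<open>E\<close> already.\<close>

lemma reduce:
  assumes S: "S \<subseteq> V" "S \<noteq> {}"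
    and F: "\<And>x y. (x, y) \<in> F \<Longrightarrow> (y, x) \<in> F" "\<And>x. (x, x) \<notin> F" "F \<subseteq> (V - S) \<times> (V - S)"
    and deg: "\<And>x. card (F `` {x}) \<le> card (N x \<inter> S)"
    and lift: "\<And>k. decomposable (del S \<union> F) k \<Longrightarrow> decomposable E (k + card S div 2)"
  obtains T where "exceptional (del S \<union> F) T" "T \<subseteq> V - S" "T \<inter> (Domain F \<union> (\<Union>s\<in>S. N s)) \<noteq> {}"
proof -
  let ?E = "del S \<union> F"
  have fin: "finite (?E `` {x})" for x
    using finite_subset[OF _ finite_V, of "?E `` {x}"] F(3) E_V del_sub by blast
  have card_S: "card S \<le> card V" "card S > 0" "card (V - S) = card V - card S"
    using S finite_V by (auto simp: card_mono card_gt_0_iff card_Diff_subset finite_subset)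
  have "card (?E `` {x}) \<le> 4" for x
  proof -
    have "?E `` {x} \<subseteq> (N x - S) \<union> F `` {x}" by (auto simp: del_def N_def)
    moreover have "finite (F `` {x})" using fin[of x] by (rule rev_finite_subset) auto
    ultimately have "card (?E `` {x}) \<le> card (N x - S) + card (F `` {x})"
      by (meson card_Un_le card_mono finite_Diff finite_N finite_UnI order_trans)
    also have "\<dots> \<le> card (N x - S) + card (N x \<inter> S)" using deg by simp
    also have "\<dots> = card (N x)"
      using card_Int_Diff[OF finite_N, of x S] by simp
    finally show ?thesis using degree[of x] by simp
  qed
  then have g: "graph4 (V - S) ?E"
    using finite_V F E_V E_sym by (auto simp: graph4_def del_def sym_def irrefl_def)
  have "\<exists>T. exceptional ?E T"
  proof (rule ccontr)
    assume "\<not> ?thesis"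
    then have "decomposable ?E (card (V - S) div 2)"
      using smaller[OF _ g] card_S by auto
    then have "decomposable E (card (V - S) div 2 + card S div 2)" by (rule lift)
    \<comment> \<open>Halving with rounding down is superadditive, so the parities of
      \<open>V\<close> and \<open>S\<close> are harmless.\<close>
    moreover have "card (V - S) div 2 + card S div 2 \<le> card V div 2" using card_S by linarith
    ultimately show False using decomposable_mono not_decomposable by blast
  qed
  then obtain T where T: "exceptional ?E T" ..
  have "T \<subseteq> V - S"
  proof
    fix t assume "t \<in> T"
    then have "?E `` {t} \<noteq> {}" using exceptional_degree_2[OF T _ fin, of t] by auto
    then show "t \<in> V - S" using E_V F(3) by (auto simp: del_def)
  qed
  moreover have "T \<inter> (Domain F \<union> (\<Union>s\<in>S. N s)) \<noteq> {}"
  proof (rule ccontr)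
    assume "\<not> ?thesis"
    then have T': "T \<inter> Domain F = {}" and "T \<inter> (\<Union>s\<in>S. N s) = {}" by auto
    then have T'': "s \<notin> S" if "t \<in> T" "(t, s) \<in> E" for t s
      using N_sym[of s t] that by (auto simp: mem_E)
    have 1: "E `` T \<subseteq> T"
    proof
      fix s assume "s \<in> E `` T"
      then obtain t where "t \<in> T" "(t, s) \<in> E" by blast
      moreover from this have "(t, s) \<in> ?E" using T'' \<open>T \<subseteq> V - S\<close> by (auto simp: del_def)
      ultimately show "s \<in> T" using exceptional_closed[OF T] by blast
    qed
    have 2: "(p, q) \<in> E" if "p \<in> T" "(p, q) \<in> ?E" for p q using that T' del_sub by auto
    show False
    proof (cases "card T = 3")
      case True
      then have "T \<times> T - Id \<subseteq> E" using 2 exceptional_3[OF T True] by blast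
      then show False using not_exceptional[of T] 1 True unfolding exceptional_def by blast
    next
      case False
      then have T5: "card T = 5" using exceptional_card[OF T] by simp
      then obtain x y where xy: "T \<times> T - Id - edge x y \<subseteq> ?E"
        using exceptional_5[OF T] unfolding near_complete_def by blast
      have "T \<times> T - Id - edge x y \<subseteq> E"
      proof (rule subrelI)
        fix p q assume "(p, q) \<in> T \<times> T - Id - edge x y"
        then have "p \<in> T" "(p, q) \<in> ?E" using xy by blast+
        then show "(p, q) \<in> E" by (rule 2)
      qed
      then have "near_complete E T" unfolding near_complete_def by blast
      then show False using not_exceptional[of T] 1 T5 unfolding exceptional_def by blast
    qed
  qed
  ultimately show thesis using T that by blast
qed

text \<open>The lists \<open>xs\<close> and \<open>ys\<close> hold the optional fourth neighbours,
  so that degrees 3 and 4 are treated together; \<open>P\<close> is \<open>xs @ [a, b] @ ys\<close>.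
  The last part of \<open>new\<close> prevents the two new edges from being parallel.\<close>

lemma lift_one_trail_each:
  assumes ab: "N a = {b, x1, x2} \<union> set xs" "N b = {a, y1, y2} \<union> set ys"
    and dist: "distinct ([b, x1, x2] @ xs)" "distinct ([a, y1, y2] @ ys)" "distinct (xs @ ys)"
    and len: "length xs \<le> 1" "length ys \<le> 1"
    and new: "(x1, x2) \<notin> E" "(y1, y2) \<notin> E" "{x1, x2} \<noteq> {y1, y2}"
    and dec: "decomposable (del {a, b} \<union> (edge x1 x2 \<union> edge y1 y2)) k"
  shows "decomposable E (k + 1)"
proof -
  have nx: "x1 \<noteq> a" "x2 \<noteq> a" "y1 \<noteq> b" "y2 \<noteq> b" "a \<noteq> b" "a \<notin> set xs" "b \<notin> set ys"
    using ab N_irrefl by blast+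
  have new': "(x2, x1) \<notin> E" "(y2, y1) \<notin> E" using new E_sym by blast+
  \<comment> \<open>While one new edge is subdivided, the other belongs to the rest of the graph, so
    the two must differ.\<close>
  have "(y1, y2) \<notin> edge x1 x2" "(y2, y1) \<notin> edge x1 x2" using new(3) by auto
  then have "decomposable (del {a, b} \<union> edge x1 x2 \<union> edge y1 b \<union> edge b y2) k"
    by (intro decomposable_subdivide[of "del {a, b} \<union> edge x1 x2"])
      (use dec nx new new' dist in \<open>auto simp: Un_assoc Field_Un del_notin_E\<close>)
  then have "decomposable ((del {a, b} \<union> edge y1 b \<union> edge b y2) \<union> edge x1 x2) k"
    by (simp add: Un_ac)
  then have dec': "decomposable (del {a, b} \<union> edge y1 b \<union> edge b y2 \<union> edge x1 a \<union> edge a x2) k"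
    by (rule decomposable_subdivide) (use nx new new' dist in \<open>auto simp: Field_Un del_notin_E\<close>)
  have xs: "xs = [] \<or> (\<exists>x. xs = [x])" and ys: "ys = [] \<or> (\<exists>x. ys = [x])"
    using len by (cases xs; cases "tl xs"; auto) (cases ys; cases "tl ys"; use len in auto)
  define X where "X = star a (set xs)"
  define Y where "Y = star b (set ys)"
  have p: "path_edges (xs @ [a, b] @ ys) = edge a b \<union> X \<union> Y"
    using xs ys by (elim disjE exE) (simp_all add: X_def Y_def edge_commute Un_ac)
  have "decomposable E (Suc k)"
  proof (rule decomposable_add_path[OF dec', of "xs @ [a, b] @ ys"])
    show "distinct (xs @ [a, b] @ ys)" using dist nx by auto
    show "path_edges (xs @ [a, b] @ ys) \<inter>
        (del {a, b} \<union> edge y1 b \<union> edge b y2 \<union> edge x1 a \<union> edge a x2) = {}"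
      using xs ys dist nx
        by (elim disjE exE; simp add: Int_Un_distrib Int_Un_distrib2 edge_del; blast)
    show "E = del {a, b} \<union> edge y1 b \<union> edge b y2 \<union> edge x1 a \<union> edge a x2 \<union>
        path_edges (xs @ [a, b] @ ys)"
      unfolding p X_def Y_def
      by (rule trans[OF E_split2[OF ab]]) (simp add: edge_commute Un_ac)
  qed
  then show ?thesis by simp
qed

lemma card_edge_Image:
  "x \<noteq> y \<Longrightarrow> card (edge x y `` {z}) \<le> (if z = x \<or> z = y then 1 else 0)"
  by (simp add: edge_Image)

lemma card_N_Int2:
  "a \<noteq> b \<Longrightarrow> card (N x \<inter> {a, b}) = (if x \<in> N a then 1 else 0) + (if x \<in> N b then 1 else 0)"
  using N_sym[of a x] N_sym[of b x] N_sym[of x a] N_sym[of x b]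
  by (auto simp: Int_insert_right)

lemma reduce_one_trail_each:
  assumes ab: "N a = {b, x1, x2} \<union> set xs" "N b = {a, y1, y2} \<union> set ys"
    and dist: "distinct ([b, x1, x2] @ xs)" "distinct ([a, y1, y2] @ ys)" "distinct (xs @ ys)"
    and len: "length xs \<le> 1" "length ys \<le> 1"
    and new: "(x1, x2) \<notin> E" "(y1, y2) \<notin> E" "{x1, x2} \<noteq> {y1, y2}"
  obtains T where "exceptional (del {a, b} \<union> (edge x1 x2 \<union> edge y1 y2)) T" "T \<subseteq> V - {a, b}"
    "T \<inter> ({x1, x2, y1, y2} \<union> set xs \<union> set ys) \<noteq> {}"
proof (rule reduce[of "{a, b}" "edge x1 x2 \<union> edge y1 y2"])
  have "a \<noteq> b" "x1 \<noteq> a" "x2 \<noteq> a" "y1 \<noteq> b" "y2 \<noteq> b" using ab N_irrefl by blast+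
  show "{a, b} \<subseteq> V" using ab N_V by blast
  show "edge x1 x2 \<union> edge y1 y2 \<subseteq> (V - {a, b}) \<times> (V - {a, b})"
    using ab N_V dist \<open>x1 \<noteq> a\<close> \<open>x2 \<noteq> a\<close> \<open>y1 \<noteq> b\<close> \<open>y2 \<noteq> b\<close> by auto
  show "(x, x) \<notin> edge x1 x2 \<union> edge y1 y2" for x using dist by auto
  \<comment> \<open>Counted separately: an end of \<open>x1 x2\<close> has lost its edge to
    \<open>a\<close>, an end of \<open>y1 y2\<close> its edge to \<open>b\<close>. A common end has
    lost both.\<close>
  show "card ((edge x1 x2 \<union> edge y1 y2) `` {x}) \<le> card (N x \<inter> {a, b})" for x
  proof -
    have "card ((edge x1 x2 \<union> edge y1 y2) `` {x}) \<le>
        card (edge x1 x2 `` {x}) + card (edge y1 y2 `` {x})"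
      unfolding Un_Image by (rule card_Un_le)
    also have "\<dots> \<le> (if x \<in> N a then 1 else 0) + (if x \<in> N b then 1 else 0)"
      by (intro add_mono order_trans[OF card_edge_Image]) (use ab dist in auto)
    also have "\<dots> = card (N x \<inter> {a, b})" using card_N_Int2[OF \<open>a \<noteq> b\<close>] by simp
    finally show ?thesis .
  qed
  show "decomposable (del {a, b} \<union> (edge x1 x2 \<union> edge y1 y2)) k \<Longrightarrow>
      decomposable E (k + card {a, b} div 2)" for k
    using lift_one_trail_each[OF ab dist len new] \<open>a \<noteq> b\<close> by simp
  show "exceptional (del {a, b} \<union> (edge x1 x2 \<union> edge y1 y2)) T \<Longrightarrow> T \<subseteq> V - {a, b} \<Longrightarrow>
      T \<inter> (Domain (edge x1 x2 \<union> edge y1 y2) \<union> (\<Union>s\<in>{a, b}. N s)) \<noteq> {} \<Longrightarrow> thesis" for T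
    by (rule that) (auto simp: ab)
qed auto

text \<open>Here \<open>ab\<close> lies on the trail \<open>s a b t\<close>, which shrinks to the
  edge \<open>st\<close>. The path \<open>P\<close> has to link \<open>a\<close> and
  \<open>b\<close> by another route, in the applications through a common neighbour, and is
  therefore supplied as a list.\<close>

lemma reduce_common_trail:
  assumes ab: "N a = {b, s} \<union> A" "N b = {a, t} \<union> B"
    and notin: "s \<noteq> b" "t \<noteq> a" "s \<notin> A" "b \<notin> A" "t \<notin> B" "a \<notin> B"
    and p: "distinct p" "path_edges p = star a A \<union> star b B"
    and new: "s \<noteq> t" "(s, t) \<notin> E"
  obtains T where "exceptional (del {a, b} \<union> edge s t) T" "T \<subseteq> V - {a, b}"
    "T \<inter> ({s, t} \<union> A \<union> B) \<noteq> {}"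
proof (rule reduce[of "{a, b}" "edge s t"])
  have ne: "a \<noteq> b" "s \<noteq> a" "t \<noteq> b" "a \<notin> A" "b \<notin> B" using ab N_irrefl by blast+
  show "{a, b} \<subseteq> V" using ab N_V by blast
  show "edge s t \<subseteq> (V - {a, b}) \<times> (V - {a, b})" using ab N_V notin ne by auto
  show "(x, x) \<notin> edge s t" for x using new by auto
  show "card (edge s t `` {x}) \<le> card (N x \<inter> {a, b})" for x
  proof -
    have "s \<in> N a" "t \<in> N b" using ab by blast+
    then show ?thesis
      unfolding card_N_Int2[OF \<open>a \<noteq> b\<close>] by (intro order_trans[OF card_edge_Image[OF \<open>s \<noteq> t\<close>]]) auto
  qed
  show "decomposable E (k + card {a, b} div 2)" if "decomposable (del {a, b} \<union> edge s t) k" for k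
  proof -
    have new': "(t, s) \<notin> E" using new E_sym by blast
    \<comment> \<open>The edge \<open>st\<close> is subdivided by \<open>a\<close>, and then its
      part \<open>at\<close> by \<open>b\<close>.\<close>
    have "decomposable (del {a, b} \<union> edge s a \<union> edge a t) k"
      by (rule decomposable_subdivide[OF that])
        (use ne new new' notin in \<open>auto simp: Field_Un del_notin_E\<close>)
    then have dec: "decomposable (del {a, b} \<union> edge s a \<union> edge a b \<union> edge b t) k"
      by (rule decomposable_subdivide) (use ne new new' notin in \<open>auto simp: Field_Un del_notin_E\<close>)
    have "decomposable E (Suc k)"
    proof (rule decomposable_add_path[OF dec p(1)])
      show "path_edges p \<inter> (del {a, b} \<union> edge s a \<union> edge a b \<union> edge b t) = {}"
        unfolding p(2) star_def using ne notin by auto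
      show "E = del {a, b} \<union> edge s a \<union> edge a b \<union> edge b t \<union> path_edges p"
        unfolding p(2) by (rule trans[OF E_split2[OF ab]]) (simp add: edge_commute Un_ac)
    qed
    then show ?thesis using \<open>a \<noteq> b\<close> by simp
  qed
  show "exceptional (del {a, b} \<union> edge s t) T \<Longrightarrow> T \<subseteq> V - {a, b} \<Longrightarrow>
      T \<inter> (Domain (edge s t) \<union> (\<Union>s\<in>{a, b}. N s)) \<noteq> {} \<Longrightarrow> thesis" for T
    by (rule that) (auto simp: ab)
qed auto

declare mem_E [simp]

lemma del_iff [simp]: "(x, y) \<in> del S \<longleftrightarrow> y \<in> N x \<and> x \<notin> S \<and> y \<notin> S"
  by (auto simp: del_def)

lemma new_Image: "x \<notin> S \<Longrightarrow> (del S \<union> F) `` {x} = (N x - S) \<union> F `` {x}"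
  by auto

lemma exceptional_del_closed:
  "exceptional (del S \<union> F) T \<Longrightarrow> T \<subseteq> V - S \<Longrightarrow> t \<in> T \<Longrightarrow> q \<in> N t \<Longrightarrow> q \<notin> S \<Longrightarrow> q \<in> T"
  by (rule exceptional_closed) auto

subsection \<open>Excluding small subgraphs\<close>

text \<open>As \<open>T\<close> is not exceptional, some edge \<open>ts\<close> leaves it. By the
  degree bound \<open>t\<close> then misses some \<open>u\<close> in \<open>T\<close>, so
  \<open>tu\<close> is the only missing pair. The reduction uses the trail \<open>s t z1 z2\<close>
  and the path \<open>z2 t z3 z1 u\<close>. Afterwards \<open>z3\<close> has only the neighbours
  \<open>u\<close> and \<open>z2\<close>, so the new exceptional set would be the triangle on
  \<open>z2\<close>, \<open>z3\<close>, \<open>u\<close>, yet it also contains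
  \<open>s\<close>.\<close>

lemma no_near_complete_5:
  assumes "T \<subseteq> V" "card T = 5" "near_complete E T"
  shows False
proof -
  obtain x y where xy: "T \<times> T - Id - edge x y \<subseteq> E" using assms(3) by (auto simp: near_complete_def)
  have "\<not> E `` T \<subseteq> T" using not_exceptional[of T] assms(2,3) by (simp add: exceptional_def)
  then obtain s where "s \<in> E `` T" "s \<notin> T" by blast
  then obtain t where t: "t \<in> T" and s: "s \<in> N t" "s \<notin> T" by auto
  have fin: "finite T" using assms(2) card.infinite by fastforce
  have "\<not> T - {t} \<subseteq> N t"
  proof
    assume "T - {t} \<subseteq> N t"
    then have "insert s (T - {t}) \<subseteq> N t" using s(1) by simp
    from card_mono[OF finite_N this] have "5 \<le> card (N t)" using s(2) t assms(2) fin by simp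
    then show False using degree[of t] by simp
  qed
  then obtain u where u: "u \<in> T" "u \<noteq> t" "u \<notin> N t" by blast
  have "card (T - {t, u}) = 3" using t u assms(2) fin by (simp add: card_Diff_subset)
  then obtain z1 z2 z3 where z: "T - {t, u} = {z1, z2, z3}" "z1 \<noteq> z2" "z2 \<noteq> z3" "z1 \<noteq> z3"
    by (auto simp: card_3_iff)
  have z': "z1 \<in> T" "z2 \<in> T" "z3 \<in> T" "z1 \<noteq> t" "z2 \<noteq> t" "z3 \<noteq> t" "z1 \<noteq> u" "z2 \<noteq> u" "z3 \<noteq> u"
    using z(1) by blast+
  have sd: "s \<noteq> t" "s \<noteq> u" "s \<noteq> z1" "s \<noteq> z2" "s \<noteq> z3" using s t u z' by auto
  have "(t, u) \<in> edge x y" using xy t u by (auto simp: subset_iff)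
  then have "edge x y = edge t u" by (auto simp: edge_commute)
  then have adj: "q \<in> N p" if "p \<in> T" "q \<in> T" "p \<noteq> q" "p \<noteq> t" "p \<noteq> u" for p q
    using xy that by (auto simp: subset_iff)
  have nt: "N t = {z1, z2, z3, s}"
    using z(2-) z' sd s adj t N_sym[of t] by (intro N_eq4) auto
  have nz1: "N z1 = {t, u, z2, z3}" and nz2: "N z2 = {t, u, z1, z3}" and nz3:
    "N z3 = {t, u, z1, z2}"
    using z(2-) z' t u adj by (intro N_eq4; auto)+
  show False
  proof (rule reduce_common_trail[of t z1 s "{z2, z3}" z2 "{u, z3}" "[z2, t, z3, z1, u]"])
    show "N t = {z1, s} \<union> {z2, z3}" "N z1 = {t, z2} \<union> {u, z3}"
      by (simp_all add: nt nz1 insert_commute)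
    show "(s, z2) \<notin> E" using N_sym[of z2 s] nz2 sd by auto
    show "path_edges [z2, t, z3, z1, u] = star t {z2, z3} \<union> star z1 {u, z3}"
      by (simp add: edge_commute Un_ac)
    fix T'
    let ?E = "del {t, z1} \<union> edge s z2"
    assume T': "exceptional ?E T'" "T' \<subseteq> V - {t, z1}" "T' \<inter> ({s, z2} \<union> {z2, z3} \<union> {u, z3}) \<noteq> {}"
    have cl: "(p, q) \<in> ?E \<Longrightarrow> p \<in> T' \<Longrightarrow> q \<in> T'" for p q using exceptional_closed[OF T'(1)] .
    have e: "(s, z2) \<in> ?E" "(z2, s) \<in> ?E" "(z3, u) \<in> ?E" "(u, z3) \<in> ?E" "(z3, z2) \<in> ?E"
      "(z2, z3) \<in> ?E"
      using z' z(2-) u sd nz3 N_sym[of u z3] N_sym[of z2 z3] by auto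
    have in_T': "z3 \<in> T'" using T'(3) e[THEN cl] by blast
    then have in_T'': "z2 \<in> T'" "u \<in> T'" "s \<in> T'" using e[THEN cl] by blast+
    have "?E `` {z3} = {u, z2}"
      using z(2-) z' u(2) sd nz3 by (simp add: new_Image edge_Image insert_Diff_if)
    then have "card T' = 3" using exceptional_degree_le_2(1)[OF T'(1) in_T'] by blast
    then have "T' = {z2, z3, u}" using in_T' in_T'' z z' by (intro card_3_eq) auto
    then show False using in_T'' sd by auto
  qed (use z(2-) z'(4-) sd u(2) in auto)
qed

section \<open>Complete subgraphs on four vertices\<close>

text \<open>The trails are \<open>d a a1\<close> and \<open>c b b1\<close>, and the path is
  \<open>c a b d\<close>. Then \<open>c\<close> has three neighbours in \<open>T\<close>, so
  \<open>T\<close> is no triangle. In a set of five, \<open>c\<close> and \<open>d\<close> both have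
  degree 3 and would have to miss each other, but \<open>cd\<close> is an edge.\<close>

lemma K4_degree_4:
  assumes n: "N a = {b, c, d, a1}" "N b = {a, c, d, b1}" "N c = {a, b, d, c1}" "N d = {a, b, c, d1}"
    and dist: "distinct [a, b, c, d, a1]" "distinct [a, b, c, d, b1]" "distinct [a, b, c, d, c1]"
      "distinct [a, b, c, d, d1]"
    and ne: "a1 \<noteq> d1" "b1 \<noteq> c1"
  shows False
proof (rule reduce_one_trail_each[of a b d a1 "[c]" c b1 "[d]"])
  show "N a = {b, d, a1} \<union> set [c]" "N b = {a, c, b1} \<union> set [d]" using n by auto
  show "(d, a1) \<notin> E" "(c, b1) \<notin> E" using n dist ne by auto
  fix T
  let ?E = "del {a, b} \<union> (edge d a1 \<union> edge c b1)"
  assume T: "exceptional ?E T" "T \<subseteq> V - {a, b}"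
    "T \<inter> ({d, a1, c, b1} \<union> set [c] \<union> set [d]) \<noteq> {}"
  have cl: "(p, q) \<in> ?E \<Longrightarrow> p \<in> T \<Longrightarrow> q \<in> T" for p q using exceptional_closed[OF T(1)] .
  have e: "(c, d) \<in> ?E" "(d, c) \<in> ?E" "(d, a1) \<in> ?E" "(a1, d) \<in> ?E" "(c, b1) \<in> ?E" "(b1, c) \<in> ?E"
    using dist n by auto
  have "c \<in> T \<or> d \<in> T \<or> a1 \<in> T \<or> b1 \<in> T" using T(3) by auto
  then have in_T: "c \<in> T" "d \<in> T" using e[THEN cl] by blast+
  have nc: "?E `` {c} = {d, b1, c1}"
    using dist n by (auto simp: new_Image Un_Image edge_Image insert_Diff_if)
  have nd: "?E `` {d} = {c, a1, d1}"
    using dist n by (auto simp: new_Image Un_Image edge_Image insert_Diff_if)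
  show False
  proof (cases "card T = 3")
    case True
    have "?E `` {c} \<subseteq> T" using cl in_T(1) by blast
    then have "{c, d, b1, c1} \<subseteq> T" unfolding nc using in_T by simp
    then have "card {c, d, b1, c1} \<le> card T" using True
      by (intro card_mono) (auto intro: card_ge_0_finite)
    moreover have "card {c, d, b1, c1} = 4" using dist ne by auto
    ultimately show False using True by simp
  next
    case False
    then have T5: "card T = 5" using exceptional_card[OF T(1)] by simp
    obtain m where m: "m \<in> T" "m \<noteq> c" "(c, m) \<notin> ?E"
      by (rule exceptional_5_missing[OF T(1) T5 in_T(1) equalityD1[OF nc]])
    obtain m' where m': "m' \<in> T" "m' \<noteq> d" "(d, m') \<notin> ?E"
      by (rule exceptional_5_missing[OF T(1) T5 in_T(2) equalityD1[OF nd]])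
    have "{c, m} = {d, m'}"
      using near_complete_unique_missing[OF exceptional_5[OF T(1) T5] _ _ _ m(3) m'(3)] m m' in_T
        by blast
    then show False using m e(1) dist by (auto simp: doubleton_eq_iff)
  qed
qed (use dist in auto)

text \<open>The trail is \<open>c a b b1\<close> and the path \<open>a d b c\<close>. Only
  \<open>c\<close> and possibly one more vertex remain adjacent to \<open>d\<close>, so
  \<open>T\<close> is the triangle on \<open>c\<close>, \<open>d\<close>, \<open>b1\<close>. This
  fixes all neighbourhoods, and the eight edges on five vertices form two Hamiltonian paths.\<close>

lemma K4_degree_3_aux:
  assumes n: "N a = {b, c, d}" "N b = {a, c, d, b1}" "{a, b, d} \<subseteq> N c" "{a, b, c} \<subseteq> N d" "b1 \<notin> N c"
    and dist: "distinct [a, b, c, d, b1]"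
  shows False
proof (rule reduce_common_trail[of a b c "{d}" b1 "{c, d}" "[a, d, b, c]"])
  show "N a = {b, c} \<union> {d}" "N b = {a, b1} \<union> {c, d}" using n by auto
  show "(c, b1) \<notin> E" using n by auto
  show "path_edges [a, d, b, c] = star a {d} \<union> star b {c, d}" by (simp add: edge_commute Un_ac)
  fix T
  let ?E = "del {a, b} \<union> edge c b1"
  assume T: "exceptional ?E T" "T \<subseteq> V - {a, b}" "T \<inter> ({c, b1} \<union> {d} \<union> {c, d}) \<noteq> {}"
  have cl: "(p, q) \<in> ?E \<Longrightarrow> p \<in> T \<Longrightarrow> q \<in> T" for p q using exceptional_closed[OF T(1)] .
  have e: "(c, d) \<in> ?E" "(d, c) \<in> ?E" "(c, b1) \<in> ?E" "(b1, c) \<in> ?E"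
    using dist n by auto
  have "c \<in> T \<or> d \<in> T \<or> b1 \<in> T" using T(3) by auto
  then have in_T: "c \<in> T" "d \<in> T" "b1 \<in> T" using e[THEN cl] by blast+
  have nd: "?E `` {d} = N d - {a, b}" using dist by (auto simp: new_Image edge_Image)
  have "{a, b, c} \<subseteq> N d" "distinct [a, b, c]" using n dist by auto
  then show False
  proof (cases rule: N_cases3)
    case 1
    then have "?E `` {d} \<subseteq> {c, c}" using nd dist by auto
    then show False using exceptional_degree_le_2(3)[OF T(1) in_T(2)] by blast
  next
    case (2 d1)
    then have nd': "?E `` {d} = {c, d1}" using nd dist by auto
    have "card T = 3" using exceptional_degree_le_2(1)[OF T(1) in_T(2)] nd' by blast
    then have T3: "T = {c, d, b1}" using in_T dist by (intro card_3_eq) auto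
    have "d1 \<in> T" using nd' in_T cl by blast
    moreover have "d1 \<noteq> d" using N_irrefl[of d] 2(1) by auto
    moreover have "d1 \<noteq> c" using 2(2) by auto
    ultimately have "d1 = b1" using T3 by simp
    then have nd: "N d = {a, b, c, b1}" using 2 by simp
    have cl': "N p \<subseteq> {a, b} \<union> T" if "p \<in> T" for p
      using exceptional_del_closed[OF T(1,2) that] by blast
    have nc: "N c = {a, b, d}" using cl'[OF in_T(1)] T3 n(3,5) by auto
    have "a \<notin> N b1" "c \<notin> N b1" "b \<in> N b1" "d \<in> N b1"
      using N_sym[of a b1] N_sym[of c b1] N_sym[of b1 b] N_sym[of b1 d] N_sym[of b b1] N_sym[of d b1] n(1,2) nc nd dist
      by auto
    then have nb1: "N b1 = {b, d}" using cl'[OF in_T(3)] T3 by auto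
    have "{a, b, c, d, b1} \<subseteq> V" using N_V[of b a] N_V[of c a] N_V[of d a] N_V[of b1 b] n(1,2)
      by auto
    then show False
    proof (rule closed_small[rotated])
      have "decomposable (\<Union>x\<in>{a, b, c, d, b1}. star x (N x)) 2"
        by (rule decomposable_two_paths[of "[a, b, c, d, b1]" "[b1, b, d, a, c]"])
          (use dist in \<open>auto simp: n(1,2) nc nd nb1 Int_Un_distrib Int_Un_distrib2 edge_commute Un_ac\<close>)
      moreover have "card {a, b, c, d, b1} = 5" using dist by simp
      ultimately show
        "decomposable (\<Union>x\<in>{a, b, c, d, b1}. star x (N x)) (card {a, b, c, d, b1} div 2)"
        by simp
      show "N x \<subseteq> {a, b, c, d, b1}" if "x \<in> {a, b, c, d, b1}" for x
        using that by (elim insertE emptyE) (simp_all add: n(1,2) nc nd nb1)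
    qed simp
  qed
qed (use dist in auto)

text \<open>Adding \<open>y\<close> yields five vertices in which only the pair \<open>a\<close>,
  \<open>y\<close> can be missing.\<close>

lemma K4_three_common:
  assumes n: "{b, c, d} \<subseteq> N a" "{a, c, d} \<subseteq> N b" "{a, b, d} \<subseteq> N c" "{a, b, c} \<subseteq> N d"
    and y: "y \<in> N b" "y \<in> N c" "y \<in> N d" "y \<noteq> a"
  shows False
proof (rule no_near_complete_5)
  have dist: "distinct [a, b, c, d, y]" using n y N_irrefl by auto
  then show "card {a, b, c, d, y} = 5" by auto
  show "{a, b, c, d, y} \<subseteq> V" using n y N_V by auto
  have "{b, c, d} \<subseteq> N y" using y N_sym by auto
  then have "{a, b, c, d, y} \<times> {a, b, c, d, y} - Id - edge a y \<subseteq> E"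
    using n y by auto
  then show "near_complete E {a, b, c, d, y}" unfolding near_complete_def by blast
qed

lemma K4_degree_3_ext:
  assumes n: "N a = {b, c, d}" "N b = {a, c, d, b1}" "{a, b, d} \<subseteq> N c" "{a, b, c} \<subseteq> N d"
    and dist: "distinct [a, b, c, d, b1]"
  shows False
proof -
  have "b1 \<in> N c" using K4_degree_3_aux[OF n _ dist] by blast
  moreover have "b1 \<in> N d"
    by (rule ccontr) (rule K4_degree_3_aux[of a b d c b1]; use n dist in auto)
  ultimately show False using K4_three_common[of b c d a b1] n dist by auto
qed

lemma K4_degree_3_N:
  assumes n: "N a = {b, c, d}" "{a, c, d} \<subseteq> N b" "{a, b, d} \<subseteq> N c" "{a, b, c} \<subseteq> N d"
    and dist: "distinct [a, b, c, d]"
  shows "N b = {a, c, d}"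
proof (rule N_cases3[OF n(2)])
  fix s assume s: "N b = {a, c, d, s}" "distinct [a, c, d, s]"
  have "s \<noteq> b" using s(1) N_irrefl[of b] by auto
  then have "distinct [a, b, c, d, s]" using s(2) dist by auto
  then show ?thesis using K4_degree_3_ext[OF n(1) s(1) n(3,4)] by blast
qed (use dist in auto)

text \<open>One vertex of degree 3 forces the other three to have degree 3. Then the graph is
  \<open>K\<^sub>4\<close>, a union of two Hamiltonian paths.\<close>

lemma K4_degree_3:
  assumes n: "N a = {b, c, d}" "{a, c, d} \<subseteq> N b" "{a, b, d} \<subseteq> N c" "{a, b, c} \<subseteq> N d"
    and dist: "distinct [a, b, c, d]"
  shows False
proof -
  have nb: "N b = {a, c, d}" by (rule K4_degree_3_N[OF n dist])
  have nc: "N c = {a, b, d}" by (rule K4_degree_3_N[of a c b d]) (use n dist in auto)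
  have nd: "N d = {a, b, c}" by (rule K4_degree_3_N[of a d b c]) (use n dist in auto)
  have "{a, b, c, d} \<subseteq> V" using N_V[of b a] N_V[of c a] N_V[of d a] n(1) by auto
  then show False
  proof (rule closed_small[rotated])
    have "decomposable (\<Union>x\<in>{a, b, c, d}. star x (N x)) 2"
      by (rule decomposable_two_paths[of "[a, b, c, d]" "[b, d, a, c]"])
        (use dist in \<open>auto simp: n(1) nb nc nd Int_Un_distrib Int_Un_distrib2 edge_commute Un_ac\<close>)
    moreover have "card {a, b, c, d} = 4" using dist by simp
    ultimately show "decomposable (\<Union>x\<in>{a, b, c, d}. star x (N x)) (card {a, b, c, d} div 2)" by simp
    show "N x \<subseteq> {a, b, c, d}" if "x \<in> {a, b, c, d}" for x
      using that by (elim insertE emptyE) (simp_all add: n(1) nb nc nd)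
  qed simp
qed

lemma no_K4:
  assumes "{b, c, d} \<subseteq> N a" "{c, d} \<subseteq> N b" "d \<in> N c"
  shows False
proof -
  have n: "{b, c, d} \<subseteq> N a" "{a, c, d} \<subseteq> N b" "{a, b, d} \<subseteq> N c" "{a, b, c} \<subseteq> N d"
    using assms N_sym[of b a] N_sym[of c a] N_sym[of d a] N_sym[of c b] N_sym[of d b] N_sym[of d c]
    by auto
  have dist: "distinct [a, b, c, d]"
    using assms n N_irrefl[of a] N_irrefl[of b] N_irrefl[of c] N_irrefl[of d] by auto
  obtain a1 where na: "N a = {b, c, d, a1}" "distinct [b, c, d, a1]"
    by (rule N_cases3[OF n(1)]) (use dist K4_degree_3[OF _ n(2-)] in auto)
  obtain b1 where nb: "N b = {a, c, d, b1}" "distinct [a, c, d, b1]"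
    by (rule N_cases3[OF n(2)]) (use dist n K4_degree_3[of b a c d] in auto)
  obtain c1 where nc: "N c = {a, b, d, c1}" "distinct [a, b, d, c1]"
    by (rule N_cases3[OF n(3)]) (use dist n K4_degree_3[of c a b d] in auto)
  obtain d1 where nd: "N d = {a, b, c, d1}" "distinct [a, b, c, d1]"
    by (rule N_cases3[OF n(4)]) (use dist n K4_degree_3[of d a b c] in auto)
  have ne: "a1 \<noteq> a" "b1 \<noteq> b" "c1 \<noteq> c" "d1 \<noteq> d"
    using na nb nc nd N_irrefl[of a] N_irrefl[of b] N_irrefl[of c] N_irrefl[of d] by auto
  have d5: "distinct [a, b, c, d, a1]" "distinct [a, b, c, d, b1]" "distinct [a, b, c, d, c1]"
      "distinct [a, b, c, d, d1]"
    using dist na(2) nb(2) nc(2) nd(2) ne by auto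
  \<comment> \<open>\<open>K4_degree_4\<close> applies directly or with \<open>c\<close> and
    \<open>d\<close> exchanged. If both ways fail, three of the four outer neighbours coincide, and
    \<open>K4_three_common\<close> applies.\<close>
  consider "a1 \<noteq> d1" "b1 \<noteq> c1" | "a1 \<noteq> c1" "b1 \<noteq> d1" | "a1 = c1" "a1 = d1" | "a1 = b1" "a1 = d1"
    | "a1 = b1" "a1 = c1" | "b1 = c1" "b1 = d1" by metis
  then show False
  proof cases
    case 1
    then show False using K4_degree_4[OF na(1) nb(1) nc(1) nd(1) d5] by blast
  next
    case 2
    have "N a = {b, d, c, a1}" "N b = {a, d, c, b1}" using na nb by auto
    from K4_degree_4[OF this nd(1) nc(1)] show False using 2 d5 by auto
  next
    case 3
    then show False using K4_three_common[of a c d b a1] n na(1) nc(1) nd(1) d5 by auto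
  next
    case 4
    then show False using K4_three_common[of a b d c a1] n na(1) nb(1) nd(1) d5 by auto
  next
    case 5
    then show False using K4_three_common[of a b c d a1] n na(1) nb(1) nc(1) d5 by auto
  next
    case 6
    then show False using K4_three_common[of b c d a b1] n nd(1) nb(1) nc(1) d5 by auto
  qed
qed

section \<open>Triangles with two vertices of degree 2, and sets free of new edges\<close>

text \<open>As the triangle is not exceptional, \<open>y\<close> has a further edge, so after
  deleting \<open>p\<close> and \<open>q\<close> some path through \<open>y\<close> can be cut there
  and its halves continued by \<open>p\<close> and by \<open>q, p\<close>. If the rest has an
  exceptional set, that is a second triangle at \<open>y\<close>, and the whole graph is two
  triangles sharing a vertex.\<close>

lemma no_pendant_triangle:
  assumes n: "N p = {q, y}" "N q = {p, y}"
  shows False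
proof (rule reduce[of "{p, q}" "{}"])
  have dist: "distinct [p, q, y]" using n N_irrefl[of p] N_irrefl[of q] by auto
  have y: "p \<in> N y" "q \<in> N y" using n N_sym[of y p] N_sym[of y q] by auto
  show V: "{p, q} \<subseteq> V" using n N_V[of q p] by auto
  show "decomposable E (k + card {p, q} div 2)" if dec: "decomposable (del {p, q} \<union> {}) k" for k
  proof -
    have "N y \<noteq> {p, q}"
    proof
      assume ny: "N y = {p, q}"
      have "{p, q, y} \<times> {p, q, y} - Id \<subseteq> E" by (auto simp: n ny)
      moreover have "E `` {p, q, y} \<subseteq> {p, q, y}" by (auto simp: n ny)
      ultimately show False using not_exceptional[of "{p, q, y}"] dist
        by (simp add: exceptional_def)
    qed
    then obtain z where z: "z \<in> N y" "z \<notin> {p, q}" using y by blast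
    then have yz: "(y, z) \<in> del {p, q}" using dist by auto
    have "decomposable (del {p, q} \<union> path_edges (y # [p]) \<union> path_edges (y # [q, p])) (Suc k)"
      by (rule decomposable_split[OF _ yz, where x = y])
        (use dec dist in \<open>auto simp: Int_Un_distrib Int_Un_distrib2 edge_del\<close>)
    moreover have "E = del {p, q} \<union> path_edges (y # [p]) \<union> path_edges (y # [q, p])"
      by (rule trans[OF E_split2[OF n]]) (simp add: edge_commute Un_ac)
    ultimately show ?thesis using dist by simp
  qed
  fix T
  let ?E = "del {p, q} \<union> {}"
  assume T: "exceptional ?E T" "T \<subseteq> V - {p, q}" "T \<inter> (Domain {} \<union> (\<Union>s\<in>{p, q}. N s)) \<noteq> {}"
  have "y \<in> T" using T(2,3) n by auto
  have nE: "?E `` {y} = N y - {p, q}" using dist new_Image[of y "{p, q}" "{}"] by auto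
  obtain r s where "N y \<subseteq> {p, q, r, s}"
  proof -
    have "{p, q} \<subseteq> N y" "distinct [p, q]" using y dist by auto
    then show thesis by (cases rule: N_cases2) (use that in blast)+
  qed
  then have "?E `` {y} \<subseteq> {r, s}" using nE by auto
  note deg = exceptional_degree_le_2[OF T(1) \<open>y \<in> T\<close> this]
  have Ny: "N y - {p, q} = {r, s}" using deg(2) nE by simp
  then have ny: "N y = {p, q, r, s}" using y by blast
  have "r \<in> N y - {p, q}" "s \<in> N y - {p, q}" unfolding Ny by simp_all
  then have rs: "r \<notin> {p, q}" "s \<notin> {p, q}" "r \<noteq> y" "s \<noteq> y" "r \<in> N y" "s \<in> N y"
    using N_irrefl[of y] by blast+
  have "r \<in> T" "s \<in> T" using exceptional_del_closed[OF T(1,2) \<open>y \<in> T\<close>] rs by blast+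
  then have T3: "T = {y, r, s}" using deg(1,3) \<open>y \<in> T\<close> rs by (intro card_3_eq) auto
  have cl: "N t \<subseteq> T" if "t = r \<or> t = s" for t
  proof -
    have "p \<notin> N t" "q \<notin> N t" using N_sym[of p t] N_sym[of q t] n rs that by auto
    then show ?thesis using exceptional_del_closed[OF T(1,2), of t] that T3 by auto
  qed
  have "(r, s) \<in> ?E" using exceptional_3[OF T(1) deg(1)] \<open>r \<in> T\<close> \<open>s \<in> T\<close> deg(3) by blast
  then have "s \<in> N r" "r \<in> N s" using N_sym by auto
  then have nr: "N r = {y, s}" and ns: "N s = {y, r}"
    using cl[of r] cl[of s] rs(5,6)[THEN N_sym] N_irrefl[of r] N_irrefl[of s] unfolding T3 by blast+
  show False
  proof (rule closed_small[of "{p, q, y, r, s}"])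
    show "{p, q, y, r, s} \<subseteq> V" using V T(2) T3 by auto
    have "decomposable (\<Union>x\<in>{p, q, y, r, s}. star x (N x)) 2"
      by (rule decomposable_two_paths[of "[p, q, y, r, s]" "[p, y, s]"])
        (use dist rs deg(3) in \<open>auto simp: n ny nr ns Int_Un_distrib Int_Un_distrib2 edge_commute Un_ac\<close>)
    moreover have "card {p, q, y, r, s} = 5" using dist rs deg(3) by auto
    ultimately show "decomposable (\<Union>x\<in>{p, q, y, r, s}. star x (N x)) (card {p, q, y, r, s} div 2)"
      by simp
    show "N x \<subseteq> {p, q, y, r, s}" if "x \<in> {p, q, y, r, s}" for x
      using that by (elim insertE emptyE) (simp_all add: n ny nr ns)
  qed simp
qed auto

subsection \<open>Excluding diamonds\<close>

lemma N_sub1: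
  assumes "p \<in> N x"
  obtains q r s where "N x \<subseteq> {p, q, r, s}"
  by (rule N_cases1[OF assms]) (blast intro: that)+

lemma N_sub2:
  assumes "p \<in> N x" "q \<in> N x" "p \<noteq> q"
  obtains r s where "N x \<subseteq> {p, q, r, s}"
proof -
  have "{p, q} \<subseteq> N x" "distinct [p, q]" using assms by auto
  then show thesis by (cases rule: N_cases2) (blast intro: that)+
qed

text \<open>All edges inside \<open>T\<close> are old, so \<open>no_near_complete_5\<close> excludes
  five vertices. In a triangle only one vertex has neighbours in \<open>S\<close>; the other two
  then have degree 2, which makes it a pendant triangle.\<close>

lemma old_exceptional:
  assumes T: "exceptional (del S \<union> F) T" "T \<subseteq> V - S" "T \<inter> Domain F = {}"
    and link: "T \<inter> (\<Union>s\<in>S. N s) \<subseteq> {t}"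
  shows False
proof -
  have old: "q \<in> N p" if "p \<in> T" "(p, q) \<in> del S \<union> F" for p q
    using that T(3) by auto
  show False
  proof (cases "card T = 5")
    case True
    obtain x y where xy: "T \<times> T - Id - edge x y \<subseteq> del S \<union> F"
      using exceptional_5[OF T(1) True] unfolding near_complete_def by blast
    have "T \<times> T - Id - edge x y \<subseteq> E"
    proof (rule subrelI)
      fix p q assume "(p, q) \<in> T \<times> T - Id - edge x y"
      then have "p \<in> T" "(p, q) \<in> del S \<union> F" using xy by blast+
      then show "(p, q) \<in> E" using old by simp
    qed
    then have "near_complete E T" unfolding near_complete_def by blast
    then show False using no_near_complete_5[of T] T(2) True by blast
  next
    case False
    then have T3: "card T = 3" using exceptional_card[OF T(1)] by simp
    \<comment> \<open>If \<open>t\<close> is outside \<open>T\<close>, nothing in \<open>T\<close>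
      is linked to \<open>S\<close>, and any vertex of \<open>T\<close> can take its place.\<close>
    have "\<exists>t'\<in>T. T \<inter> (\<Union>s\<in>S. N s) \<subseteq> {t'}"
    proof (cases "t \<in> T")
      case False
      have "T \<noteq> {}" using T3 by auto
      then obtain r where "r \<in> T" by blast
      moreover have "T \<inter> (\<Union>s\<in>S. N s) = {}" using link False by blast
      ultimately show ?thesis by blast
    qed (use link in blast)
    then obtain t' where t': "t' \<in> T" "T \<inter> (\<Union>s\<in>S. N s) \<subseteq> {t'}" by blast
    obtain p q where pq: "T = {t', p, q}" "distinct [t', p, q]"
      by (rule card_3_extend1[OF T3 t'(1)])
    have sub: "N r \<subseteq> T" if "r \<in> T" "r \<noteq> t'" for r
    proof
      fix s assume s: "s \<in> N r"
      then have "s \<notin> S" using N_sym[OF s] t'(2) that by blast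
      then show "s \<in> T" using exceptional_del_closed[OF T(1,2) that(1) s] by blast
    qed
    have e: "q \<in> N p" "p \<in> N q" "t' \<in> N p" "t' \<in> N q"
      by (rule old[OF _ exceptional_3[OF T(1) T3]]; use pq in auto)+
    have "p \<in> T" "p \<noteq> t'" "q \<in> T" "q \<noteq> t'" using pq by auto
    then have "N p \<subseteq> T" "N q \<subseteq> T" using sub by blast+
    then have "N p = {q, t'}" "N q = {p, t'}"
      using e N_irrefl[of p] N_irrefl[of q] unfolding pq(1) by blast+
    then show False by (rule no_pendant_triangle)
  qed
qed

text \<open>The two numbers in \<open>diamond_3_3\<close> etc. are the degrees of the ends of the central edge \<open>u v\<close>;
  the other two vertices are \<open>w\<close> and \<open>z\<close>.\<close>

lemma diamond_3_3_aux:
  assumes n: "N u = {v, w, z}" "N v = {u, w, z}" and t: "t \<in> N w" "t \<noteq> u" "t \<noteq> v"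
    and dist: "distinct [u, v, w, z]"
  shows False
proof (rule reduce[of "{u, v}" "{}"])
  have mem: "u \<in> N w" "v \<in> N w" "u \<in> N z" "v \<in> N z"
    using N_sym[of w u] N_sym[of w v] N_sym[of z u] N_sym[of z v] n by simp_all
  show V: "{u, v} \<subseteq> V" using n N_V[of v u] by auto
  have z: "z \<notin> N w"
  proof
    assume "z \<in> N w"
    then show False using no_K4[of v w z u] n by simp
  qed
  show "decomposable E (k + card {u, v} div 2)" if dec: "decomposable (del {u, v} \<union> {}) k" for k
  proof -
    have wt: "(w, t) \<in> del {u, v}" using t dist by auto
    \<comment> \<open>The five deleted edges extend the two halves of a path through
      \<open>w\<close>. Only the extension \<open>u z v\<close> returns to the old graph, namely at
      \<open>z\<close>; this is why the split tolerates one such vertex.\<close>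
    have "decomposable (del {u, v} \<union> path_edges (w # [u, z, v]) \<union> path_edges (w # [v, u])) (Suc k)"
      by (rule decomposable_split[OF _ wt, where x = z])
        (use dec dist in \<open>auto simp: Int_Un_distrib Int_Un_distrib2 edge_del\<close>)
    moreover have "E = del {u, v} \<union> path_edges (w # [u, z, v]) \<union> path_edges (w # [v, u])"
      by (rule trans[OF E_split2[OF n]]) (simp add: edge_commute Un_ac)
    ultimately show ?thesis using dist by simp
  qed
  fix T
  assume T: "exceptional (del {u, v} \<union> {}) T" "T \<subseteq> V - {u, v}"
    "T \<inter> (Domain {} \<union> (\<Union>s\<in>{u, v}. N s)) \<noteq> {}"
  have link: "T \<inter> (\<Union>s\<in>{u, v}. N s) \<subseteq> {w, z}" using T(2) by (auto simp: n)
  show False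
  proof (cases "w \<in> T \<and> z \<in> T")
    case True
    show False
    proof (cases "card T = 3")
      case True
      then show False using exceptional_3[OF T(1) True, of w z] \<open>w \<in> T \<and> z \<in> T\<close> dist z by auto
    next
      case False
      then have "card T = 5" using exceptional_card[OF T(1)] by simp
      moreover from this have "near_complete E T"
        using exceptional_5[OF T(1)] del_sub[of "{u, v}"] unfolding near_complete_def by fastforce
      ultimately show False using no_near_complete_5 T(2) by blast
    qed
  next
    case False
    then show False
      using old_exceptional[OF T(1,2), of w] old_exceptional[OF T(1,2), of z] link by blast
  qed
qed auto

text \<open>Applied to \<open>w\<close> and to \<open>z\<close>, the previous lemma leaves both with
  degree 2, so the graph is just the diamond.\<close>

lemma diamond_3_3:
  assumes n: "N u = {v, w, z}" "N v = {u, w, z}" and dist: "distinct [u, v, w, z]"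
  shows False
proof -
  have nw: "N w = {u, v}"
  proof -
    have "u \<in> N w" "v \<in> N w" using N_sym[of w u] N_sym[of w v] n by simp_all
    moreover have "N w \<subseteq> {u, v}" using diamond_3_3_aux[OF n _ _ _ dist] by blast
    ultimately show ?thesis by blast
  qed
  have nz: "N z = {u, v}"
  proof -
    have n': "N u = {v, z, w}" "N v = {u, z, w}" "distinct [u, v, z, w]" using n dist by auto
    have "u \<in> N z" "v \<in> N z" using N_sym[of z u] N_sym[of z v] n by simp_all
    moreover have "N z \<subseteq> {u, v}" using diamond_3_3_aux[OF n'(1,2) _ _ _ n'(3)] by blast
    ultimately show ?thesis by blast
  qed
  have V: "{u, v, w, z} \<subseteq> V" using N_V[of v u] N_V[of w u] N_V[of z u] n by auto
  show False
  proof (rule closed_small[OF _ V])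
    show "N x \<subseteq> {u, v, w, z}" if "x \<in> {u, v, w, z}" for x
      using that by (elim insertE emptyE) (simp_all add: n nw nz)
    have "decomposable (\<Union>x\<in>{u, v, w, z}. star x (N x)) 2"
      by (rule decomposable_two_paths[of "[u, v, w]" "[v, z, u, w]"])
        (use dist in \<open>auto simp: n nw nz Int_Un_distrib Int_Un_distrib2 edge_commute Un_ac\<close>)
    moreover have "card {u, v, w, z} = 4" using dist by auto
    ultimately show "decomposable (\<Union>x\<in>{u, v, w, z}. star x (N x)) (card {u, v, w, z} div 2)"
      by simp
  qed simp
qed

text \<open>Without \<open>K\<^sub>4\<close> the common neighbours \<open>w\<close>,
  \<open>z\<close>, \<open>y\<close> are pairwise non-adjacent. The trails \<open>z u y\<close> and
  \<open>w v y\<close> force all three into \<open>T\<close>, where \<open>wz\<close> is still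
  missing. So \<open>T\<close> has five vertices and every other pair is adjacent. This determines a
  4-regular graph on seven vertices, whose 14 edges split into three paths.\<close>

lemma book:
  assumes n: "N u = {v, w, z, y}" "N v = {u, w, z, y}"
    and dist: "distinct [u, v, w, z, y]"
  shows False
proof (rule reduce_one_trail_each[of u v z y "[w]" w y "[z]"])
  have mem: "u \<in> N w" "v \<in> N w" "u \<in> N z" "v \<in> N z" "u \<in> N y" "v \<in> N y"
    using N_sym[of w u] N_sym[of w v] N_sym[of z u] N_sym[of z v] N_sym[of y u] N_sym[of y v] n
    by simp_all
  have ind: "z \<notin> N w" "y \<notin> N w" "y \<notin> N z"
    using no_K4[of v w z u] no_K4[of v w y u] no_K4[of v z y u] by (auto simp: n)
  show "(z, y) \<notin> E" "(w, y) \<notin> E" using ind by simp_all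
  fix T
  let ?E = "del {u, v} \<union> (edge z y \<union> edge w y)"
  assume T: "exceptional ?E T" "T \<subseteq> V - {u, v}"
    "T \<inter> ({z, y, w, y} \<union> set [w] \<union> set [z]) \<noteq> {}"
  have cl: "(p, q) \<in> ?E \<Longrightarrow> p \<in> T \<Longrightarrow> q \<in> T" for p q using exceptional_closed[OF T(1)] .
  have e: "(z, y) \<in> ?E" "(y, z) \<in> ?E" "(w, y) \<in> ?E" "(y, w) \<in> ?E" by simp_all
  have "z \<in> T \<or> y \<in> T \<or> w \<in> T" using T(3) by auto
  then have in_T: "w \<in> T" "z \<in> T" "y \<in> T" using e[THEN cl] by blast+
  have wz: "(w, z) \<notin> ?E" using ind dist by auto
  have T5: "card T = 5"
    using exceptional_3[OF T(1) _ in_T(1,2)] wz dist exceptional_card[OF T(1)] by auto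
  have "{w, z, y} \<subseteq> T" "distinct [w, z, y]" using in_T dist by auto
  then obtain p q where pq: "T = {w, z, y, p, q}" "distinct [w, z, y, p, q]"
    by (rule card_5_extend3[OF T5])
  have uv: "u \<notin> T" "v \<notin> T" using T(2) by auto
  have adj: "(s, t) \<in> ?E" if "s \<in> T" "t \<in> T" "s \<noteq> t" "{s, t} \<noteq> {w, z}" for s t
    using exceptional_one_missing[OF T(1) T5, of s t w z] that in_T wz dist by auto
  have a: "p \<in> N w" "q \<in> N w" "p \<in> N z" "q \<in> N z" "p \<in> N y" "q \<in> N y" "q \<in> N p"
    using adj[of w p] adj[of w q] adj[of z p] adj[of z q] adj[of y p] adj[of y q] adj[of p q] pq
    by (simp_all add: doubleton_eq_iff) metis+
  note b = a[THEN N_sym]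
  have d7: "distinct [u, v, w, z, y, p, q]" using dist pq uv by auto
  have nw: "N w = {u, v, p, q}" and nz: "N z = {u, v, p, q}" and ny: "N y = {u, v, p, q}"
    and np: "N p = {w, z, y, q}" and nq: "N q = {w, z, y, p}"
    by (intro N_eq4; use mem a b d7 in simp)+
  let ?W = "{u, v, w, z, y, p, q}"
  have V: "?W \<subseteq> V" using T(2) pq(1) N_V[OF mem(1)] N_V[OF mem(2)] by blast
  show False
  proof (rule closed_small[OF _ V])
    show "N x \<subseteq> ?W" if "x \<in> ?W" for x
      using that by (elim insertE emptyE) (simp_all add: n nw nz ny np nq)
    have "decomposable (\<Union>x\<in>?W. star x (N x)) 3"
      by (rule decomposable_three_paths[of "[p, y, q, z, v, u, w]" "[p, q, w, v, y, u, z]" "[w, p, z]"])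
        (use d7 in \<open>auto simp: n nw nz ny np nq Int_Un_distrib Int_Un_distrib2 edge_commute Un_ac\<close>)
    moreover have "card ?W = 7" using d7 by auto
    ultimately show "decomposable (\<Union>x\<in>?W. star x (N x)) (card ?W div 2)" by simp
  qed simp
qed (use dist n in auto)

text \<open>Here the reduction with \<open>P = w u v v1\<close> fails because of \<open>T\<close>. The one with \<open>P = u1 u v w\<close> then
  works: it joins \<open>v1\<close> to \<open>T\<close>, and the resulting component is too large to be exceptional.\<close>

lemma diamond_4_4_distant:
  assumes n: "N u = {v, w, z, u1}" "N v = {u, w, z, v1}"
    and dist: "distinct [u, v, w, z, u1, v1]" and ind: "z \<notin> N w" "u1 \<notin> N z"
    and T: "exceptional (del {u, v} \<union> (edge z u1 \<union> edge w z)) T" "T \<subseteq> V - {u, v}"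
    and in_T: "w \<in> T" "z \<in> T" "u1 \<in> T" "v1 \<notin> T"
  shows False
proof (rule reduce_one_trail_each[of u v w z "[u1]" z v1 "[w]"])
  let ?E = "del {u, v} \<union> (edge z u1 \<union> edge w z)"
  have ind': "v1 \<notin> N z" "v \<notin> N u1"
    using exceptional_del_closed[OF T in_T(2), of v1] in_T(4) dist n(2) N_sym[of v u1] by auto
  show "N u = {v, w, z} \<union> set [u1]" "N v = {u, z, v1} \<union> set [w]" using n by auto
  show "(w, z) \<notin> E" "(z, v1) \<notin> E" using ind ind' by simp_all
  fix T'
  let ?E' = "del {u, v} \<union> (edge w z \<union> edge z v1)"
  assume T': "exceptional ?E' T'" "T' \<subseteq> V - {u, v}"
    "T' \<inter> ({w, z, z, v1} \<union> set [u1] \<union> set [w]) \<noteq> {}"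
  have cl: "(p, q) \<in> ?E' \<Longrightarrow> p \<in> T' \<Longrightarrow> q \<in> T'" for p q using exceptional_closed[OF T'(1)] .
  have e: "(w, z) \<in> ?E'" "(z, w) \<in> ?E'" "(z, v1) \<in> ?E'" "(v1, z) \<in> ?E'" by simp_all
  \<comment> \<open>A set that avoids \<open>z\<close> avoids both new edges, and \<open>u1\<close>
    is then the only vertex through which it can be linked to \<open>u\<close> or
    \<open>v\<close>.\<close>
  have z: "z \<in> T'"
  proof (rule ccontr)
    assume "z \<notin> T'"
    then have "w \<notin> T'" "v1 \<notin> T'" using e[THEN cl] by blast+
    with \<open>z \<notin> T'\<close> show False
      by (intro old_exceptional[OF T'(1,2), of u1]) (use T'(2) in \<open>auto simp: n\<close>)
  qed
  then have in_T': "w \<in> T'" "v1 \<in> T'" using e[THEN cl] by blast+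
  \<comment> \<open>The second reduction keeps every edge of the first one except
    \<open>z u1\<close>, so it carries \<open>T'\<close> through almost all of
    \<open>T\<close>.\<close>
  have real: "q \<in> T'" if "p \<in> T'" "(p, q) \<in> ?E" "{p, q} \<noteq> {z, u1}" for p q
  proof -
    have "(p, q) \<in> ?E' \<or> q = w \<or> q = z" using that(2,3) by (auto simp: doubleton_eq_iff)
    then show ?thesis using cl that(1) in_T'(1) z by blast
  qed
  show False
  proof (cases "card T = 3")
    case True
    have T3: "T = {z, w, u1}" using True in_T dist by (intro card_3_eq) auto
    have "(w, u1) \<in> ?E" using exceptional_3[OF T(1) True in_T(1,3)] dist by auto
    \<comment> \<open>Without its new edge to \<open>z\<close>, the vertex \<open>u1\<close> keeps
      at most the neighbour \<open>w\<close>, too few for an exceptional set.\<close>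
    then have u1: "u1 \<in> T'" using real[OF in_T'(1)] dist by (auto simp: doubleton_eq_iff)
    have "N u1 \<subseteq> {u, v} \<union> T" using exceptional_del_closed[OF T in_T(3)] by blast
    then have "N u1 - {u, v} \<subseteq> {w}" using ind(2) N_sym[of z u1] N_irrefl[of u1] unfolding T3
      by blast
    moreover have "?E' `` {u1} = N u1 - {u, v}" using dist by (auto simp: new_Image)
    ultimately have "?E' `` {u1} \<subseteq> {w, w}" by simp
    then show False using exceptional_degree_le_2(3)[OF T'(1) u1] by blast
  next
    case False
    then have T5: "card T = 5" using exceptional_card[OF T(1)] by simp
    have "{z, w, u1} \<subseteq> T" "distinct [z, w, u1]" using in_T dist by auto
    then obtain p q where pq: "T = {z, w, u1, p, q}" "distinct [z, w, u1, p, q]"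
      by (rule card_5_extend3[OF T5])
    \<comment> \<open>Two vertices of \<open>T'\<close> could both lead to \<open>s\<close>; at most
      one of these pairs is missing.\<close>
    have reach: "s \<in> T'" if s: "{x, y, s} \<subseteq> T" "distinct [x, y, s]" "x \<in> T'" "y \<in> T'"
        "{x, s} \<noteq> {z, u1}" "{y, s} \<noteq> {z, u1}" for s x y
    proof -
      have "{x, s} \<noteq> {y, s}" using s(2) by (auto simp: doubleton_eq_iff)
      then have "(x, s) \<in> ?E \<or> (y, s) \<in> ?E"
        using s(1,2) by (intro exceptional_one_missing[OF T(1) T5]) auto
      then show ?thesis using real s(3-6) by blast
    qed
    have p: "p \<in> T'"
      by (rule reach[of z w p]) (use z in_T' pq dist in \<open>auto simp: doubleton_eq_iff\<close>)
    have q: "q \<in> T'"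
      by (rule reach[of z w q]) (use z in_T' pq dist in \<open>auto simp: doubleton_eq_iff\<close>)
    have u1: "u1 \<in> T'"
      by (rule reach[of w p u1]) (use z in_T' p pq dist in \<open>auto simp: doubleton_eq_iff\<close>)
    show False
      by (rule exceptional_not_6[OF T'(1), of z w u1 p q v1])
        (use pq in_T(4) z in_T' p q u1 in auto)
  qed
qed (use dist in auto)

text \<open>The trails are \<open>z u u1\<close> and \<open>w v z\<close>, the path is
  \<open>w u v v1\<close>. By the previous lemma \<open>T\<close> also contains \<open>v1\<close>,
  so it has exactly one further vertex \<open>q\<close>. Once the missing pair of \<open>T\<close>
  is identified, a 4-regular graph on seven vertices remains.\<close>

lemma diamond_4_4_nonadjacent:
  assumes n: "N u = {v, w, z, u1}" "N v = {u, w, z, v1}"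
    and dist: "distinct [u, v, w, z, u1, v1]" and ind: "z \<notin> N w" "u1 \<notin> N z"
  shows False
proof (rule reduce_one_trail_each[of u v z u1 "[w]" w z "[v1]"])
  show "N u = {v, z, u1} \<union> set [w]" "N v = {u, w, z} \<union> set [v1]" using n by auto
  show "(z, u1) \<notin> E" "(w, z) \<notin> E" using ind by simp_all
  fix T
  let ?E = "del {u, v} \<union> (edge z u1 \<union> edge w z)"
  assume T: "exceptional ?E T" "T \<subseteq> V - {u, v}"
    "T \<inter> ({z, u1, w, z} \<union> set [w] \<union> set [v1]) \<noteq> {}"
  have cl: "(p, q) \<in> ?E \<Longrightarrow> p \<in> T \<Longrightarrow> q \<in> T" for p q using exceptional_closed[OF T(1)] .
  have e: "(w, z) \<in> ?E" "(z, w) \<in> ?E" "(z, u1) \<in> ?E" "(u1, z) \<in> ?E" by simp_all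
  have z: "z \<in> T"
  proof (rule ccontr)
    assume "z \<notin> T"
    then have "w \<notin> T" "u1 \<notin> T" using e[THEN cl] by blast+
    with \<open>z \<notin> T\<close> show False
      by (intro old_exceptional[OF T(1,2), of v1]) (use T(2) in \<open>auto simp: n\<close>)
  qed
  then have in_T: "w \<in> T" "u1 \<in> T" using e[THEN cl] by blast+
  have v1: "v1 \<in> T"
    using diamond_4_4_distant[OF n dist ind T(1,2) in_T(1) z in_T(2)] by blast
  have mem: "u \<in> N w" "v \<in> N w" "u \<in> N z" "v \<in> N z" "u \<in> N u1" "v \<in> N v1"
    using N_sym[of w u] N_sym[of w v] N_sym[of z u] N_sym[of z v] N_sym[of u1 u] N_sym[of v1 v] n
    by simp_all
  have T4: "{z, w, u1, v1} \<subseteq> T" "distinct [z, w, u1, v1]" using z in_T v1 dist by auto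
  have T5: "card T = 5" by (rule exceptional_4_imp_5[OF T(1) T4])
  obtain q where q: "T = {z, w, u1, v1, q}" "distinct [z, w, u1, v1, q]"
    by (rule card_5_extend4[OF T5 T4])
  have uv: "u \<notin> T" "v \<notin> T" using T(2) by auto
  \<comment> \<open>After losing edges to \<open>u\<close> and \<open>v\<close>, both
    \<open>w\<close> and \<open>v1\<close> have at most three neighbours, so the missing pair is
    \<open>w\<close>, \<open>v1\<close>.\<close>
  have wv1: "(w, v1) \<notin> ?E"
  proof -
    obtain r s where "N w \<subseteq> {u, v, r, s}" using N_sub2[OF mem(1,2)] dist by auto
    then have "?E `` {w} \<subseteq> {z, r, s}" using dist by (auto simp: new_Image Un_Image edge_Image)
    then obtain m where m: "m \<in> T" "m \<noteq> w" "(w, m) \<notin> ?E"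
      by (rule exceptional_5_missing[OF T(1) T5 in_T(1)])
    obtain r s t where "N v1 \<subseteq> {v, r, s, t}" by (rule N_sub1[OF mem(6)])
    then have "?E `` {v1} \<subseteq> {r, s, t}" using dist by (auto simp: new_Image Un_Image edge_Image)
    then obtain m' where m': "m' \<in> T" "m' \<noteq> v1" "(v1, m') \<notin> ?E"
      by (rule exceptional_5_missing[OF T(1) T5 v1])
    have "{w, m} = {v1, m'}"
      using exceptional_one_missing[OF T(1) T5, of w m v1 m'] m m' in_T v1 by blast
    then have "m = v1" using dist by (auto simp: doubleton_eq_iff)
    then show ?thesis using m by simp
  qed
  have adj: "(s, t) \<in> ?E" if "s \<in> T" "t \<in> T" "s \<noteq> t" "{s, t} \<noteq> {w, v1}" for s t
    using exceptional_one_missing[OF T(1) T5, of s t w v1] that in_T v1 wv1 dist by auto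
  have a: "u1 \<in> N w" "q \<in> N w" "v1 \<in> N z" "q \<in> N z" "v1 \<in> N u1" "q \<in> N u1" "q \<in> N v1"
    using adj[of w u1] adj[of w q] adj[of z v1] adj[of z q] adj[of u1 v1] adj[of u1 q] adj[of v1 q] q dist
    by (auto simp: doubleton_eq_iff)
  note b = a[THEN N_sym]
  have d7: "distinct [u, v, w, z, u1, v1, q]" using dist q uv by auto
  have nw: "N w = {u, v, u1, q}" and nz: "N z = {u, v, v1, q}" and nu1: "N u1 = {u, w, v1, q}"
    and nv1: "N v1 = {v, z, u1, q}" and nq: "N q = {w, z, u1, v1}"
    by (intro N_eq4; use mem a b d7 in simp)+
  let ?W = "{u, v, w, z, u1, v1, q}"
  have V: "?W \<subseteq> V" using T(2) q(1) N_V[OF mem(1)] N_V[OF mem(2)] by blast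
  show False
  proof (rule closed_small[OF _ V])
    show "N x \<subseteq> ?W" if "x \<in> ?W" for x
      using that by (elim insertE emptyE) (simp_all add: n nw nz nu1 nv1 nq)
    have "decomposable (\<Union>x\<in>?W. star x (N x)) 3"
      by (rule decomposable_three_paths[of "[q, z, v, u, w, u1, v1]" "[q, u1, u, z, v1, v, w]" "[v1, q, w]"])
        (use d7 in \<open>auto simp: n nw nz nu1 nv1 nq Int_Un_distrib Int_Un_distrib2 edge_commute Un_ac\<close>)
    moreover have "card ?W = 7" using d7 by auto
    ultimately show "decomposable (\<Union>x\<in>?W. star x (N x)) (card ?W div 2)" by simp
  qed simp
qed (use dist in auto)

text \<open>If \<open>u1 v1\<close> is an edge, this is the octahedron with opposite pairs
  \<open>u, v1\<close>, \<open>v, u1\<close> and \<open>w, z\<close>. Otherwise \<open>u\<close> and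
  \<open>w\<close> are deleted with trails \<open>v u u1\<close> and \<open>u1 w v1\<close>; then
  \<open>v\<close> and \<open>z\<close> both have degree at most 3 in a set of five, although they
  are adjacent.\<close>

lemma octahedron:
  assumes n: "N u = {v, w, z, u1}" "N v = {u, w, z, v1}" "N w = {u, v, u1, v1}"
    "N z = {u, v, u1, v1}"
    and dist: "distinct [u, v, w, z, u1, v1]"
  shows False
proof (cases "v1 \<in> N u1")
  case True
  have mem: "u \<in> N u1" "w \<in> N u1" "z \<in> N u1" "v \<in> N v1" "w \<in> N v1" "z \<in> N v1"
    using N_sym[of u1 u] N_sym[of u1 w] N_sym[of u1 z] N_sym[of v1 v] N_sym[of v1 w] N_sym[of v1 z] n
    by simp_all
  have nu1: "N u1 = {u, w, z, v1}" and nv1: "N v1 = {v, w, z, u1}"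
    by (intro N_eq4; use mem True N_sym[OF True] dist in simp)+
  let ?W = "{u, v, w, z, u1, v1}"
  have V: "?W \<subseteq> V" using N_V[of v u] N_V[of w u] N_V[of z u] N_V[of u1 u] N_V[of v1 v] n by auto
  show False
  proof (rule closed_small[OF _ V])
    show "N x \<subseteq> ?W" if "x \<in> ?W" for x
      using that by (elim insertE emptyE) (simp_all add: n nu1 nv1)
    have "decomposable (\<Union>x\<in>?W. star x (N x)) 3"
      by (rule decomposable_three_paths[of "[u, v, v1, w, u1, z]" "[u, w, v, z, v1, u1]" "[u1, u, z]"])
        (use dist in \<open>auto simp: n nu1 nv1 Int_Un_distrib Int_Un_distrib2 edge_commute Un_ac\<close>)
    moreover have "card ?W = 6" using dist by auto
    ultimately show "decomposable (\<Union>x\<in>?W. star x (N x)) (card ?W div 2)" by simp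
  qed simp
next
  case False
  show False
  proof (rule reduce_one_trail_each[of u w v u1 "[z]" u1 v1 "[v]"])
    show "N u = {w, v, u1} \<union> set [z]" "N w = {u, u1, v1} \<union> set [v]" using n by auto
    show "(v, u1) \<notin> E" "(u1, v1) \<notin> E" using False dist by (auto simp: n)
    fix T
    let ?E = "del {u, w} \<union> (edge v u1 \<union> edge u1 v1)"
    assume T: "exceptional ?E T" "T \<subseteq> V - {u, w}"
      "T \<inter> ({v, u1, u1, v1} \<union> set [z] \<union> set [v]) \<noteq> {}"
    have cl: "(p, q) \<in> ?E \<Longrightarrow> p \<in> T \<Longrightarrow> q \<in> T" for p q using exceptional_closed[OF T(1)] .
    have e: "(v, u1) \<in> ?E" "(u1, v) \<in> ?E" "(u1, v1) \<in> ?E" "(v1, u1) \<in> ?E" "(v, z) \<in> ?E"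
      "(z, v) \<in> ?E"
      using dist by (auto simp: n)
    have "v \<in> T \<or> u1 \<in> T \<or> v1 \<in> T \<or> z \<in> T" using T(3) by auto
    then have in_T: "v \<in> T" "u1 \<in> T" "v1 \<in> T" "z \<in> T" using e[THEN cl] by blast+
    have T4: "{v, u1, v1, z} \<subseteq> T" "distinct [v, u1, v1, z]" using in_T dist by auto
    have T5: "card T = 5" by (rule exceptional_4_imp_5[OF T(1) T4])
    have "?E `` {z} \<subseteq> {v, u1, v1}" using dist by (auto simp: n)
    then obtain m where m: "m \<in> T" "m \<noteq> z" "(z, m) \<notin> ?E"
      by (rule exceptional_5_missing[OF T(1) T5 in_T(4)])
    have "?E `` {v} \<subseteq> {z, v1, u1}" using dist by (auto simp: n)
    then obtain m' where m': "m' \<in> T" "m' \<noteq> v" "(v, m') \<notin> ?E"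
      by (rule exceptional_5_missing[OF T(1) T5 in_T(1)])
    have "{z, m} = {v, m'}"
      using exceptional_one_missing[OF T(1) T5, of z m v m'] m m' in_T by blast
    then have "m = v" using dist by (auto simp: doubleton_eq_iff)
    then show False using m(3) e(6) by blast
  qed (use dist in auto)
qed

text \<open>Exchanging \<open>u\<close> with \<open>v\<close> and \<open>w\<close> with
  \<open>z\<close> gives four versions of the non-adjacent case. Their failure makes
  \<open>w\<close> and \<open>z\<close> adjacent to both \<open>u1\<close> and
  \<open>v1\<close>.\<close>

lemma diamond_4_4:
  assumes n: "N u = {v, w, z, u1}" "N v = {u, w, z, v1}"
    and dist: "distinct [u, v, w, z, u1]" "distinct [u, v, w, z, v1]"
  shows False
proof (cases "u1 = v1")
  case True
  then show False using book[OF n(1)] n(2) dist(1) by simp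
next
  case False
  have d: "distinct [u, v, w, z, u1, v1]" using dist False by auto
  have ind: "z \<notin> N w" "w \<notin> N z" using no_K4[of v w z u] N_sym[of w z] by (auto simp: n)
  have n': "N u = {v, z, w, u1}" "N v = {u, z, w, v1}" using n by auto
  have "u1 \<in> N z" using diamond_4_4_nonadjacent[OF n d ind(1)] by blast
  moreover have "u1 \<in> N w" using diamond_4_4_nonadjacent[OF n' _ ind(2)] d by auto
  moreover have "v1 \<in> N z" using diamond_4_4_nonadjacent[OF n(2,1) _ ind(1)] d by auto
  moreover have "v1 \<in> N w" using diamond_4_4_nonadjacent[OF n'(2,1) _ ind(2)] d by auto
  moreover have "u \<in> N w" "v \<in> N w" "u \<in> N z" "v \<in> N z"
    using N_sym[of w u] N_sym[of w v] N_sym[of z u] N_sym[of z v] n by simp_all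
  ultimately have "N w = {u, v, u1, v1}" "N z = {u, v, u1, v1}"
    using d by (intro N_eq4; simp)+
  then show False using octahedron[OF n _ _ d] by blast
qed

lemma E_split: "E = del S \<union> (\<Union>x\<in>S. star x (N x))"
proof (intro equalityI subrelI)
  fix x y assume "(x, y) \<in> E"
  then have "y \<in> N x" "x \<in> N y" using N_sym by simp_all
  then show "(x, y) \<in> del S \<union> (\<Union>x\<in>S. star x (N x))" by (auto simp: star_def)
next
  fix x y assume "(x, y) \<in> del S \<union> (\<Union>x\<in>S. star x (N x))"
  then have "y \<in> N x \<or> x \<in> N y" by (auto simp: star_def)
  then show "(x, y) \<in> E" using N_sym by auto
qed

text \<open>The trails \<open>w u z\<close> and \<open>z v v1\<close> put \<open>w\<close>,
  \<open>z\<close> and \<open>v1\<close> into \<open>T\<close>. A triangle leaves a graph on five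
  vertices. In a set of five, \<open>w\<close> has only three neighbours and misses some
  \<open>m\<close> other than \<open>z\<close>; every choice of \<open>m\<close> determines a graph
  on seven vertices with 13 edges.\<close>

lemma diamond_3_4_nonadjacent:
  assumes n: "N u = {v, w, z}" "N v = {u, w, z, v1}"
    and dist: "distinct [u, v, w, z, v1]" and ind: "v1 \<notin> N z"
  shows False
proof (rule reduce_one_trail_each[of u v w z "[]" z v1 "[w]"])
  have mem: "u \<in> N w" "v \<in> N w" "u \<in> N z" "v \<in> N z" "v \<in> N v1"
    using N_sym[of w u] N_sym[of w v] N_sym[of z u] N_sym[of z v] N_sym[of v1 v] n by simp_all
  have ind': "z \<notin> N w" "w \<notin> N z" "z \<notin> N v1" "u \<notin> N v1"
    using no_K4[of v w z u] N_sym[of w z] ind N_sym[of z v1] N_sym[of v1 z] N_sym[of u v1] dist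
    by (auto simp: n)
  show "N u = {v, w, z} \<union> set []" "N v = {u, z, v1} \<union> set [w]" using n by auto
  show "(w, z) \<notin> E" "(z, v1) \<notin> E" using ind ind' by simp_all
  fix T
  let ?E = "del {u, v} \<union> (edge w z \<union> edge z v1)"
  assume T: "exceptional ?E T" "T \<subseteq> V - {u, v}"
    "T \<inter> ({w, z, z, v1} \<union> set [] \<union> set [w]) \<noteq> {}"
  have cl: "(p, q) \<in> ?E \<Longrightarrow> p \<in> T \<Longrightarrow> q \<in> T" for p q using exceptional_closed[OF T(1)] .
  have e: "(w, z) \<in> ?E" "(z, w) \<in> ?E" "(z, v1) \<in> ?E" "(v1, z) \<in> ?E" by simp_all
  have "w \<in> T \<or> z \<in> T \<or> v1 \<in> T" using T(3) by auto
  then have in_T: "w \<in> T" "z \<in> T" "v1 \<in> T" using e[THEN cl] by blast+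
  have sub: "N t \<subseteq> {u, v} \<union> T" if "t \<in> T" for t
    using exceptional_del_closed[OF T(1,2) that] by blast
  have uv: "u \<notin> T" "v \<notin> T" using T(2) by auto
  have V: "{u, v} \<union> T \<subseteq> V" using T(2) N_V[OF mem(1)] N_V[OF mem(2)] by blast
  show False
  proof (cases "card T = 3")
    case True
    have T3: "T = {w, z, v1}" using True in_T dist by (intro card_3_eq) auto
    have "(w, v1) \<in> ?E" using exceptional_3[OF T(1) True in_T(1,3)] dist by auto
    then have wv1: "v1 \<in> N w" using dist by auto
    have nw: "N w = {u, v, v1}" and nz: "N z = {u, v}" and nv1: "N v1 = {v, w}"
      using sub[OF in_T(1)] sub[OF in_T(2)] sub[OF in_T(3)] mem wv1 N_sym[OF wv1] ind ind'
        N_irrefl[of w] N_irrefl[of z] N_irrefl[of v1] unfolding T3 by blast+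
    let ?W = "{u, v, w, z, v1}"
    show False
    proof (rule closed_small[of ?W])
      show "?W \<subseteq> V" using V T3 by blast
      show "N x \<subseteq> ?W" if "x \<in> ?W" for x
        using that by (elim insertE emptyE) (simp_all add: n nw nz nv1)
      have "decomposable (\<Union>x\<in>?W. star x (N x)) 2"
        by (rule decomposable_two_paths[of "[w, v1, v, u, z]" "[u, w, v, z]"])
          (use dist in \<open>auto simp: n nw nz nv1 Int_Un_distrib Int_Un_distrib2 edge_commute Un_ac\<close>)
      moreover have "card ?W = 5" using dist by auto
      ultimately show "decomposable (\<Union>x\<in>?W. star x (N x)) (card ?W div 2)" by simp
    qed simp
  next
    case False
    then have T5: "card T = 5" using exceptional_card[OF T(1)] by simp
    have "{w, z, v1} \<subseteq> T" "distinct [w, z, v1]" using in_T dist by auto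
    then obtain p q where pq: "T = {w, z, v1, p, q}" "distinct [w, z, v1, p, q]"
      by (rule card_5_extend3[OF T5])
    obtain r s where "N w \<subseteq> {u, v, r, s}" using N_sub2[OF mem(1,2)] dist by auto
    then have "?E `` {w} \<subseteq> {z, r, s}" using dist by (auto simp: new_Image Un_Image edge_Image)
    then obtain m where m: "m \<in> T" "m \<noteq> w" "(w, m) \<notin> ?E"
      by (rule exceptional_5_missing[OF T(1) T5 in_T(1)])
    have adj: "(s, t) \<in> ?E" if "s \<in> T" "t \<in> T" "s \<noteq> t" "{s, t} \<noteq> {w, m}" for s t
      using exceptional_one_missing[OF T(1) T5, of s t w m] that in_T m by blast
    \<comment> \<open>\<open>p\<close> and \<open>q\<close> are interchangeable, so the choices
      \<open>m = p\<close> and \<open>m = q\<close> are handled at once.\<close>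
    have q_missing: False if pq: "T = {w, z, v1, p, q}" "distinct [w, z, v1, p, q]" and mq:
      "m = q" for p q
    proof -
      have a: "v1 \<in> N w" "p \<in> N w" "p \<in> N z" "q \<in> N z" "p \<in> N v1" "q \<in> N v1" "q \<in> N p"
        using adj[of w v1] adj[of w p] adj[of z p] adj[of z q] adj[of v1 p] adj[of v1 q] adj[of p q]
          pq(2) dist unfolding pq(1) mq by (auto simp: doubleton_eq_iff)
      note b = a[THEN N_sym]
      have d7: "distinct [u, v, w, z, v1, p, q]" using dist pq uv by auto
      have nw: "N w = {u, v, v1, p}" and nz: "N z = {u, v, p, q}" and nv1: "N v1 = {v, w, p, q}"
        and np: "N p = {w, z, v1, q}"
        by (intro N_eq4; use mem a b d7 in simp)+
      have "q \<in> T" "u \<notin> N q" "v \<notin> N q" "w \<notin> N q"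
        using pq(1) N_sym[of u q] N_sym[of v q] N_sym[of w q] d7 by (auto simp: n nw)
      then have nq: "N q = {z, v1, p}" using sub[of q] b N_irrefl[of q] unfolding pq(1) by blast
      let ?W = "{u, v, w, z, v1, p, q}"
      show False
      proof (rule closed_small[of ?W])
        show "?W \<subseteq> V" using V pq(1) by blast
        show "N x \<subseteq> ?W" if "x \<in> ?W" for x
          using that by (elim insertE emptyE) (simp_all add: n nw nz nv1 np nq)
        have "decomposable (\<Union>x\<in>?W. star x (N x)) 3"
          by (rule decomposable_three_paths[of "[p, v1, q, z, v, w, u]" "[q, p, w, v1, v, u, z]" "[p, z]"])
            (use d7 in \<open>auto simp: n nw nz nv1 np nq Int_Un_distrib Int_Un_distrib2 edge_commute Un_ac\<close>)
        moreover have "card ?W = 7" using d7 by auto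
        ultimately show "decomposable (\<Union>x\<in>?W. star x (N x)) (card ?W div 2)" by simp
      qed simp
    qed
    have "m \<noteq> z" using m(3) e(1) by blast
    then consider "m = v1" | "m = p" | "m = q" using m(1,2) unfolding pq(1) by blast
    then show False
    proof cases
      case 1
      have a: "p \<in> N w" "q \<in> N w" "p \<in> N z" "q \<in> N z" "p \<in> N v1" "q \<in> N v1" "q \<in> N p"
        using adj[of w p] adj[of w q] adj[of z p] adj[of z q] adj[of v1 p] adj[of v1 q] adj[of p q]
          pq(2) dist unfolding pq(1) 1 by (auto simp: doubleton_eq_iff)
      note b = a[THEN N_sym]
      have d7: "distinct [u, v, w, z, v1, p, q]" using dist pq uv by auto
      have nw: "N w = {u, v, p, q}" and nz: "N z = {u, v, p, q}" and np: "N p = {w, z, v1, q}"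
        and nq: "N q = {w, z, v1, p}"
        by (intro N_eq4; use mem a b d7 in simp)+
      have "w \<notin> N v1" using N_sym[of w v1] d7 by (auto simp: nw)
      then have nv1: "N v1 = {v, p, q}"
        using sub[OF in_T(3)] ind' mem a N_irrefl[of v1] unfolding pq(1) by blast
      let ?W = "{u, v, w, z, v1, p, q}"
      show False
      proof (rule closed_small[of ?W])
        show "?W \<subseteq> V" using V pq(1) by blast
        show "N x \<subseteq> ?W" if "x \<in> ?W" for x
          using that by (elim insertE emptyE) (simp_all add: n nw nz nv1 np nq)
        have "decomposable (\<Union>x\<in>?W. star x (N x)) 3"
          by (rule decomposable_three_paths[of "[p, v1, q, z, v, u, w]" "[u, z, p, q, w, v, v1]" "[p, w]"])
            (use d7 in \<open>auto simp: n nw nz nv1 np nq Int_Un_distrib Int_Un_distrib2 edge_commute Un_ac\<close>)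
        moreover have "card ?W = 7" using d7 by auto
        ultimately show "decomposable (\<Union>x\<in>?W. star x (N x)) (card ?W div 2)" by simp
      qed simp
    next
      case 2
      have "T = {w, z, v1, q, p}" "distinct [w, z, v1, q, p]" using pq by auto
      then show False using q_missing 2 by blast
    next
      case 3
      then show False using q_missing pq by blast
    qed
  qed
qed (use dist in auto)

text \<open>A wheel with hub \<open>v\<close> and rim \<open>u w v1 z\<close>, attached to the rest
  only at \<open>v1\<close>. Its eight edges form two paths, exactly what four deleted vertices pay
  for. No exceptional set arises, since \<open>v1\<close> keeps at most one neighbour.\<close>

lemma wheel:
  assumes n: "N u = {v, w, z}" "N v = {u, w, z, v1}" "N w = {u, v, v1}" "N z = {u, v, v1}"
    and dist: "distinct [u, v, w, z, v1]"
  shows False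
proof (rule reduce[of "{u, v, w, z}" "{}"])
  let ?S = "{u, v, w, z}"
  show "?S \<subseteq> V" using N_V[of v u] N_V[of w u] N_V[of z u] n by auto
  have mem: "v \<in> N v1" "w \<in> N v1" "z \<in> N v1"
    using N_sym[of v1 v] N_sym[of v1 w] N_sym[of v1 z] n by simp_all
  show "decomposable E (k + card ?S div 2)" if dec: "decomposable (del ?S \<union> {}) k" for k
  proof -
    have
      "decomposable (del ?S \<union> (path_edges [u, v, w, v1, z] \<union> path_edges [v1, v, z, u, w])) (k + 2)"
    proof (rule decomposable_Un)
      show "decomposable (del ?S) k" using dec by simp
      show "decomposable (path_edges [u, v, w, v1, z] \<union> path_edges [v1, v, z, u, w]) 2"
        by (rule decomposable_two_paths[OF _ _ _ refl])
          (use dist in \<open>auto simp: Int_Un_distrib Int_Un_distrib2\<close>)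
      show "del ?S \<inter> (path_edges [u, v, w, v1, z] \<union> path_edges [v1, v, z, u, w]) = {}"
        by (simp add: Int_Un_distrib Int_commute[of "del ?S"] edge_del)
    qed
    moreover have "E = del ?S \<union> (path_edges [u, v, w, v1, z] \<union> path_edges [v1, v, z, u, w])"
      by (rule trans[OF E_split[of ?S]]) (simp add: n edge_commute Un_ac)
    moreover have "card ?S = 4" using dist by auto
    ultimately show ?thesis by simp
  qed
  fix T
  assume T: "exceptional (del ?S \<union> {}) T" "T \<subseteq> V - ?S"
    "T \<inter> (Domain {} \<union> (\<Union>s\<in>?S. N s)) \<noteq> {}"
  have v1: "v1 \<in> T" using T(2,3) by (auto simp: n)
  obtain r where "N v1 \<subseteq> {v, w, z, r}"
  proof -
    have "{v, w, z} \<subseteq> N v1" "distinct [v, w, z]" using mem dist by auto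
    then show thesis by (cases rule: N_cases3) (blast intro: that)+
  qed
  then have "(del ?S \<union> {}) `` {v1} \<subseteq> {r, r}" by auto
  then show False using exceptional_degree_le_2(3)[OF T(1) v1] by blast
qed auto

text \<open>If \<open>w\<close> had degree 4, then \<open>vw\<close> would be the central edge of a
  diamond with ends of degree 4 and common neighbours \<open>u\<close>, \<open>v1\<close>; likewise
  for \<open>z\<close>. What remains is the wheel.\<close>

lemma diamond_3_4:
  assumes n: "N u = {v, w, z}" "N v = {u, w, z, v1}" and dist: "distinct [u, v, w, z, v1]"
  shows False
proof -
  have n': "N u = {v, z, w}" "N v = {u, z, w, v1}" using n by auto
  have z: "v1 \<in> N z" using diamond_3_4_nonadjacent[OF n dist] by blast
  have w: "v1 \<in> N w" using diamond_3_4_nonadjacent[OF n'] dist by auto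
  have mem: "u \<in> N w" "v \<in> N w" "u \<in> N z" "v \<in> N z"
    using N_sym[of w u] N_sym[of w v] N_sym[of z u] N_sym[of z v] n by simp_all
  have nw: "N w = {u, v, v1}"
  proof (rule N_cases3)
    show "{u, v, v1} \<subseteq> N w" "distinct [u, v, v1]" using mem w dist by auto
    fix w2 assume *: "N w = {u, v, v1, w2}" "distinct [u, v, v1, w2]"
    have "w2 \<noteq> w" using * N_irrefl[of w] by auto
    moreover have "N v = {w, u, v1, z}" "N w = {v, u, v1, w2}" using n *(1) by auto
    ultimately show ?thesis using diamond_4_4[of v w u v1 z w2] dist *(2) by auto
  qed
  have nz: "N z = {u, v, v1}"
  proof (rule N_cases3)
    show "{u, v, v1} \<subseteq> N z" "distinct [u, v, v1]" using mem z dist by auto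
    fix z2 assume *: "N z = {u, v, v1, z2}" "distinct [u, v, v1, z2]"
    have "z2 \<noteq> z" using * N_irrefl[of z] by auto
    moreover have "N v = {z, u, v1, w}" "N z = {v, u, v1, z2}" using n *(1) by auto
    ultimately show ?thesis using diamond_4_4[of v z u v1 w z2] dist *(2) by auto
  qed
  show False by (rule wheel[OF n nw nz dist])
qed

text \<open>From here on every edge lies in at most one triangle.\<close>

lemma no_diamond:
  assumes "v \<in> N u" "w \<in> N u" "z \<in> N u" "w \<in> N v" "z \<in> N v" "w \<noteq> z"
  shows False
proof -
  have "u \<in> N v" using assms(1) by (rule N_sym)
  then have uv: "{v, w, z} \<subseteq> N u" "{u, w, z} \<subseteq> N v" using assms by auto
  have ne: "u \<noteq> v" "u \<noteq> w" "u \<noteq> z" "v \<noteq> w" "v \<noteq> z" using assms N_irrefl by blast+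
  show False
  proof (rule N_cases3[OF uv(1)])
    assume nu: "N u = {v, w, z}"
    show False
    proof (rule N_cases3[OF uv(2)])
      show "N v = {u, w, z} \<Longrightarrow> False" using diamond_3_3[OF nu] ne assms(6) by auto
      fix v1 assume *: "N v = {u, w, z, v1}" "distinct [u, w, z, v1]"
      then have "v1 \<noteq> v" using N_irrefl[of v] by auto
      then show False using diamond_3_4[OF nu *(1)] *(2) ne by auto
    qed (use ne assms(6) in auto)
  next
    fix u1 assume u1: "N u = {v, w, z, u1}" "distinct [v, w, z, u1]"
    then have "u1 \<noteq> u" using N_irrefl[of u] by auto
    show False
    proof (rule N_cases3[OF uv(2)])
      assume "N v = {u, w, z}"
      then show False using diamond_3_4[OF _ u1(1)] u1(2) \<open>u1 \<noteq> u\<close> ne by auto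
    next
      fix v1 assume *: "N v = {u, w, z, v1}" "distinct [u, w, z, v1]"
      then have "v1 \<noteq> v" using N_irrefl[of v] by auto
      then show False using diamond_4_4[OF u1(1) *(1)] *(2) u1(2) \<open>u1 \<noteq> u\<close> ne by auto
    qed (use ne assms(6) in auto)
  qed (use ne assms(6) in auto)
qed

subsection \<open>Excluding triangles and edges\<close>

text \<open>All new edges inside \<open>T\<close> meet \<open>c\<close>, so the other four vertices
  are joined by old edges, with at most one pair missing. They span a diamond or a
  \<open>K\<^sub>4\<close>.\<close>

lemma exceptional_5_diamond:
  assumes T: "exceptional (del S \<union> F) T" "card T = 5" and c: "c \<in> T"
    and F: "\<And>p q. (p, q) \<in> F \<Longrightarrow> p \<in> T \<Longrightarrow> q \<in> T \<Longrightarrow> p = c \<or> q = c"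
  shows False
proof -
  have fin: "finite T" using T(2) by (auto intro: card_ge_0_finite)
  have "card (T - {c}) = 4" using c T(2) by simp
  then have "T - {c} \<noteq> {}" by (metis card.empty zero_neq_numeral)
  then obtain x where x: "x \<in> T - {c}" by blast
  then have "card {c, x} = 2" by auto
  then have "card (T - {c, x}) = 3" using x c T(2) fin by (simp add: card_Diff_subset)
  then obtain p q r where pqr: "T - {c, x} = {p, q, r}" "p \<noteq> q" "q \<noteq> r" "p \<noteq> r"
    by (auto simp: card_3_iff)
  have mem: "x \<in> T" "p \<in> T" "q \<in> T" "r \<in> T" "x \<noteq> c" "p \<noteq> c" "q \<noteq> c" "r \<noteq> c" "p \<noteq> x" "q \<noteq> x" "r \<noteq> x"
    using pqr(1) x by blast+
  have one: "t \<in> N s \<or> t' \<in> N s'"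
    if "s \<in> T" "t \<in> T" "s' \<in> T" "t' \<in> T" "s \<noteq> t" "s' \<noteq> t'" "{s, t} \<noteq> {s', t'}"
      "s \<noteq> c" "t \<noteq> c" "s' \<noteq> c" "t' \<noteq> c" for s t s' t'
    using exceptional_one_missing[OF T, of s t s' t'] that F[of s t] F[of s' t'] by auto
  have dia: False if s: "s \<in> T" "t \<in> T" "s' \<in> T" "t' \<in> T" "distinct [s, t, s', t', c]"
      "t' \<notin> N s'" for s t s' t'
  proof -
    have "t \<in> N s" "s' \<in> N s" "t' \<in> N s" "s' \<in> N t" "t' \<in> N t"
      using one[of s t s' t'] one[of s s' s' t'] one[of s t' s' t'] one[of t s' s' t'] one[of t t' s' t'] s
      by (auto simp: doubleton_eq_iff)
    then show False using no_diamond[of t s s' t'] s(5) by auto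
  qed
  have d: "distinct [x, p, q, r, c]" using mem pqr by auto
  have "p \<in> N x" "q \<in> N x" "r \<in> N x" "q \<in> N p" "r \<in> N p"
    using dia[of q r x p] dia[of p r x q] dia[of p q x r] dia[of x r p q] dia[of x q p r] mem d
      by auto
  then show False using no_diamond[of p x q r] pqr by blast
qed

text \<open>The vertex \<open>a\<close> only subdivides \<open>xy\<close>, so its removal needs no
  extra path, in accordance with \<open>card {a} div 2 = 0\<close>. A set \<open>T\<close> of five
  contains a diamond, and a triangle \<open>T\<close> means that the whole graph is a
  4-cycle.\<close>

lemma no_suppressible:
  assumes n: "N a = {x, y}" and ne: "x \<noteq> y" and xy: "y \<notin> N x"
  shows False
proof (rule reduce[of "{a}" "edge x y"])
  have mem: "a \<in> N x" "a \<in> N y" using N_sym[of x a] N_sym[of y a] n by simp_all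
  have a: "a \<noteq> x" "a \<noteq> y" using mem N_irrefl by blast+
  have yx: "x \<notin> N y" using xy N_sym by blast
  show "{a} \<subseteq> V" using N_V[OF mem(1)] by simp
  show "edge x y \<subseteq> (V - {a}) \<times> (V - {a})" using N_V[OF mem(1)] N_V[OF mem(2)] a by auto
  show "(z, z) \<notin> edge x y" for z using ne by auto
  show "card (edge x y `` {z}) \<le> card (N z \<inter> {a})" for z
    using mem by (intro order_trans[OF card_edge_Image[OF ne]]) auto
  show "decomposable E (k + card {a} div 2)" if "decomposable (del {a} \<union> edge x y) k" for k
  proof -
    have "decomposable (del {a} \<union> edge x a \<union> edge a y) k"
      by (rule decomposable_subdivide[OF that]) (use ne xy yx a in \<open>auto simp: Field_Un\<close>)
    moreover have "E = del {a} \<union> edge x a \<union> edge a y"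
      by (rule trans[OF E_split[of "{a}"]]) (simp add: n edge_commute Un_ac)
    ultimately show ?thesis by simp
  qed
  fix T
  let ?E = "del {a} \<union> edge x y"
  assume T: "exceptional ?E T" "T \<subseteq> V - {a}" "T \<inter> (Domain (edge x y) \<union> (\<Union>s\<in>{a}. N s)) \<noteq> {}"
  have cl: "(p, q) \<in> ?E \<Longrightarrow> p \<in> T \<Longrightarrow> q \<in> T" for p q using exceptional_closed[OF T(1)] .
  have e: "(x, y) \<in> ?E" "(y, x) \<in> ?E" by simp_all
  have "x \<in> T \<or> y \<in> T" using T(3) by (auto simp: n)
  then have in_T: "x \<in> T" "y \<in> T" using e[THEN cl] by blast+
  show False
  proof (cases "card T = 3")
    case False
    then have "card T = 5" using exceptional_card[OF T(1)] by simp
    then show False by (rule exceptional_5_diamond[OF T(1) _ in_T(1)]) auto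
  next
    case True
    obtain r where r: "T = {x, y, r}" "r \<noteq> x" "r \<noteq> y"
      by (rule card_3_extend2[OF True _ ne]) (use in_T in auto)
    have "(x, r) \<in> ?E" "(y, r) \<in> ?E" using exceptional_3[OF T(1) True] r by auto
    then have rN: "r \<in> N x" "r \<in> N y" using r by auto
    have sub: "N t \<subseteq> {a} \<union> T" if "t \<in> T" for t
      using exceptional_del_closed[OF T(1,2) that] by blast
    have ra: "r \<noteq> a" "a \<notin> N r" using r T(2) N_sym[of a r] by (auto simp: n)
    have nx: "N x = {a, r}" and ny: "N y = {a, r}" and nr: "N r = {x, y}"
      using sub[of x] sub[of y] sub[of r] mem rN rN[THEN N_sym] N_irrefl xy yx ra unfolding r(1)
        by blast+
    show False
    proof (rule closed_small[of "{a, x, y, r}"])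
      show "{a, x, y, r} \<subseteq> V" using N_V[OF mem(1)] T(2) r(1) by blast
      show "N z \<subseteq> {a, x, y, r}" if "z \<in> {a, x, y, r}" for z
        using that by (elim insertE emptyE) (simp_all add: n nx ny nr)
      have "decomposable (\<Union>z\<in>{a, x, y, r}. star z (N z)) 2"
        by (rule decomposable_two_paths[of "[x, a, y, r]" "[r, x]"])
          (use a ne r ra in \<open>auto simp: n nx ny nr Int_Un_distrib Int_Un_distrib2 edge_commute Un_ac\<close>)
      moreover have "card {a, x, y, r} = 4" using a ne r ra by auto
      ultimately show "decomposable (\<Union>z\<in>{a, x, y, r}. star z (N z)) (card {a, x, y, r} div 2)"
        by simp
    qed simp
  qed
qed auto

text \<open>For \<open>a\<close> of small degree: only \<open>b\<close> lies on a trail, while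
  \<open>ab\<close> and all other edges at \<open>a\<close> go into the supplied path.\<close>

lemma reduce_one_trail:
  assumes ab: "N a = insert b A" "N b = {a, y1, y2} \<union> B"
    and notin: "b \<notin> A" "y1 \<noteq> a" "y2 \<noteq> a" "a \<notin> B" "y1 \<notin> B" "y2 \<notin> B"
    and p: "distinct p" "path_edges p = edge a b \<union> star a A \<union> star b B"
    and new: "y1 \<noteq> y2" "(y1, y2) \<notin> E"
  obtains T where "exceptional (del {a, b} \<union> edge y1 y2) T" "T \<subseteq> V - {a, b}"
    "T \<inter> ({y1, y2} \<union> A \<union> B) \<noteq> {}"
proof (rule reduce[of "{a, b}" "edge y1 y2"])
  have ne: "a \<noteq> b" "y1 \<noteq> b" "y2 \<noteq> b" "a \<notin> A" "b \<notin> B" using ab N_irrefl by blast+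
  have mem: "y1 \<in> N b" "y2 \<in> N b" "a \<in> N b" using ab by blast+
  show "{a, b} \<subseteq> V" using N_V[OF mem(3)] by simp
  show "edge y1 y2 \<subseteq> (V - {a, b}) \<times> (V - {a, b})"
    using N_V[OF mem(1)] N_V[OF mem(2)] notin ne by auto
  show "(z, z) \<notin> edge y1 y2" for z using new by auto
  show "card (edge y1 y2 `` {z}) \<le> card (N z \<inter> {a, b})" for z
    using mem unfolding card_N_Int2[OF ne(1)]
      by (intro order_trans[OF card_edge_Image[OF new(1)]]) auto
  show "decomposable E (k + card {a, b} div 2)" if "decomposable (del {a, b} \<union> edge y1 y2) k" for k
  proof -
    have new': "(y2, y1) \<notin> E" using new E_sym by blast
    have dec: "decomposable (del {a, b} \<union> edge y1 b \<union> edge b y2) k"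
      by (rule decomposable_subdivide[OF that]) (use ne new new' notin in \<open>auto simp: Field_Un del_notin_E\<close>)
    have "decomposable E (Suc k)"
    proof (rule decomposable_add_path[OF dec p(1)])
      show "path_edges p \<inter> (del {a, b} \<union> edge y1 b \<union> edge b y2) = {}"
        unfolding p(2) star_def using ne notin by auto
      show "E = del {a, b} \<union> edge y1 b \<union> edge b y2 \<union> path_edges p"
        unfolding p(2) by (rule trans[OF E_split2[OF ab]]) (simp add: edge_commute Un_ac)
    qed
    then show ?thesis using ne by simp
  qed
  show "exceptional (del {a, b} \<union> edge y1 y2) T \<Longrightarrow> T \<subseteq> V - {a, b} \<Longrightarrow>
      T \<inter> (Domain (edge y1 y2) \<union> (\<Union>s\<in>{a, b}. N s)) \<noteq> {} \<Longrightarrow> thesis" for T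
    by (rule that) (auto simp: ab)
qed auto

text \<open>The trail is \<open>c b b2\<close>. A triangle \<open>T\<close> through the new edge has
  a third vertex whose only neighbours are the non-adjacent \<open>c\<close> and \<open>b2\<close>,
  hence a suppressible one. A set that avoids \<open>c\<close> is linked to \<open>a\<close> and
  \<open>b\<close> through \<open>ys\<close> alone.\<close>

lemma triangle_degree_2:
  assumes n: "N a = {b, c}" "N b = {a, c, b2} \<union> set ys"
    and dist: "distinct ([a, b, c, b2] @ ys)" and len: "length ys \<le> 1"
  shows False
proof (rule reduce_one_trail[of a b "{c}" c b2 "set ys" "[c, a, b] @ ys"])
  have mem: "a \<in> N c" "b \<in> N c" "b \<in> N b2" "c \<in> N b"
    using N_sym[of c a] N_sym[of c b] N_sym[of b2 b] n by simp_all
  have common: "t = a" if "t \<in> N b" "t \<in> N c" for t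
    using no_diamond[of c b a t] that mem n by auto
  have ys: "ys = [] \<or> (\<exists>y. ys = [y])" using len by (cases ys; cases "tl ys") auto
  show "N a = insert b {c}" "N b = {a, c, b2} \<union> set ys" by (rule n)+
  show "path_edges ([c, a, b] @ ys) = edge a b \<union> star a {c} \<union> star b (set ys)"
    using ys by (elim disjE exE) (simp_all add: edge_commute Un_ac)
  have b2: "b2 \<notin> N c" using common[of b2] n dist by auto
  then show "(c, b2) \<notin> E" by simp
  fix T
  let ?E = "del {a, b} \<union> edge c b2"
  assume T: "exceptional ?E T" "T \<subseteq> V - {a, b}" "T \<inter> ({c, b2} \<union> {c} \<union> set ys) \<noteq> {}"
  have cl: "(p, q) \<in> ?E \<Longrightarrow> p \<in> T \<Longrightarrow> q \<in> T" for p q using exceptional_closed[OF T(1)] .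
  have e: "(c, b2) \<in> ?E" "(b2, c) \<in> ?E" by simp_all
  have sub: "N t \<subseteq> {a, b} \<union> T" if "t \<in> T" for t
    using exceptional_del_closed[OF T(1,2) that] by blast
  show False
  proof (cases "c \<in> T")
    case True
    then have b2T: "b2 \<in> T" using e[THEN cl] by blast
    show False
    proof (cases "card T = 3")
      case False
      then have "card T = 5" using exceptional_card[OF T(1)] by simp
      then show False by (rule exceptional_5_diamond[OF T(1) _ True]) auto
    next
      case T3: True
      obtain p where p: "T = {c, b2, p}" "p \<noteq> c" "p \<noteq> b2"
        by (rule card_3_extend2[OF T3, of c b2]) (use True b2T dist in auto)
      have "(c, p) \<in> ?E" "(b2, p) \<in> ?E" using exceptional_3[OF T(1) T3] p by auto
      then have pN: "p \<in> N c" "p \<in> N b2" using p by auto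
      have "p \<noteq> a" "p \<noteq> b" using T(2) p(1) by auto
      then have "a \<notin> N p" "b \<notin> N p" using N_sym[of a p] N_sym[of b p] common[of p] pN p
        by (auto simp: n)
      moreover have "p \<in> T" using p by simp
      ultimately have "N p = {c, b2}" using sub[of p] pN[THEN N_sym] N_irrefl[of p] unfolding p(1)
        by blast
      then show False using no_suppressible[of p c b2] b2 dist by auto
    qed
  next
    case False
    then have "b2 \<notin> T" using e[THEN cl] by blast
    obtain t where "set ys \<subseteq> {t}" using ys by fastforce
    then show False
      using False \<open>b2 \<notin> T\<close> T(2) by (intro old_exceptional[OF T(1,2), of t]) (auto simp: n)
  qed
qed (use dist in auto)

text \<open>Both new edges meet in \<open>c\<close>, so a \<open>T\<close> through \<open>c\<close>
  is excluded by diamonds or by the suppressible vertex \<open>a2\<close>. The reduction can thus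
  fail only through an old triangle containing both fourth neighbours. The conclusion records that
  failure for use with different choices of \<open>b1\<close>.\<close>

lemma triangle_degree_ge_3:
  assumes n: "N a = {b, c, a2} \<union> set xs" "N b = {a, c, b2} \<union> set ys"
    and dist: "distinct ([a, b, c, a2] @ xs)" "distinct ([a, b, c, b2] @ ys)"
    and len: "length xs \<le> 1" "length ys \<le> 1"
  shows "\<exists>a1 b1 r. xs = [a1] \<and> ys = [b1] \<and> N a1 = {a, b1, r} \<and> N r = {a1, b1}"
proof (rule reduce_one_trail_each[of a b c a2 xs c b2 ys])
  have mem: "a \<in> N c" "b \<in> N c" "a \<in> N b" "b \<in> N a" "c \<in> N a" "c \<in> N b" "a \<in> N a2" "b \<in> N b2"
    using N_sym[of c a] N_sym[of c b] N_sym[of a2 a] N_sym[of b2 b] n by simp_all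
  have common: "t = c" if "t \<in> N a" "t \<in> N b" for t
    using no_diamond[of b a c t] that mem by auto
  have common_a: "t = b" if "t \<in> N a" "t \<in> N c" for t
    using no_diamond[of c a b t] that mem by auto
  have common_b: "t = a" if "t \<in> N b" "t \<in> N c" for t
    using no_diamond[of c b a t] that mem by auto
  have in_n: "a2 \<in> N a" "b2 \<in> N b" "\<And>x. x \<in> set xs \<Longrightarrow> x \<in> N a" "\<And>y. y \<in> set ys \<Longrightarrow> y \<in> N b"
    using n by simp_all
  have a2b2: "a2 \<notin> N b" "b2 \<notin> N a" using common in_n dist by auto
  have a2c: "a2 \<notin> N c" "b2 \<notin> N c" using common_a common_b in_n dist by auto
  show "distinct (xs @ ys)" using dist common in_n by auto
  show "(c, a2) \<notin> E" "(c, b2) \<notin> E" using a2c by simp_all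
  show "{c, a2} \<noteq> {c, b2}" using a2b2 in_n by (auto simp: doubleton_eq_iff)
  fix T
  let ?E = "del {a, b} \<union> (edge c a2 \<union> edge c b2)"
  assume T: "exceptional ?E T" "T \<subseteq> V - {a, b}"
    "T \<inter> ({c, a2, c, b2} \<union> set xs \<union> set ys) \<noteq> {}"
  have cl: "(p, q) \<in> ?E \<Longrightarrow> p \<in> T \<Longrightarrow> q \<in> T" for p q using exceptional_closed[OF T(1)] .
  have e: "(c, b2) \<in> ?E" "(b2, c) \<in> ?E" "(c, a2) \<in> ?E" "(a2, c) \<in> ?E" by simp_all
  have sub: "N t \<subseteq> {a, b} \<union> T" if "t \<in> T" for t
    using exceptional_del_closed[OF T(1,2) that] by blast
  show ?thesis
  proof (cases "c \<in> T")
    case True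
    then have in_T: "a2 \<in> T" "b2 \<in> T" using e[THEN cl] by blast+
    show ?thesis
    proof (cases "card T = 3")
      case False
      then have "card T = 5" using exceptional_card[OF T(1)] by simp
      then have False by (rule exceptional_5_diamond[OF T(1) _ True]) auto
      then show ?thesis ..
    next
      case T3: True
      have ne: "a2 \<noteq> b2" using a2b2 in_n by auto
      have Teq: "T = {c, a2, b2}" using True in_T ne dist by (intro card_3_eq[OF T3]) auto
      have "(a2, b2) \<in> ?E" using exceptional_3[OF T(1) T3 in_T ne] .
      then have "b2 \<in> N a2" using ne dist by auto
      moreover have "b \<notin> N a2" "c \<notin> N a2" using a2b2(1) a2c(1) N_sym by blast+
      ultimately have "N a2 = {a, b2}"
        using sub[OF in_T(1)] mem N_irrefl[of a2] unfolding Teq by blast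
      then have False using no_suppressible[of a2 a b2] a2b2(2) dist(2) by auto
      then show ?thesis ..
    qed
  next
    case False
    then have notin: "c \<notin> T" "a2 \<notin> T" "b2 \<notin> T" using e[THEN cl] by blast+
    have xs: "xs = [] \<or> (\<exists>x. xs = [x])" using len by (cases xs; cases "tl xs") auto
    have ys: "ys = [] \<or> (\<exists>x. ys = [x])" using len by (cases ys; cases "tl ys") auto
    have two: "\<not> T \<inter> (set xs \<union> set ys) \<subseteq> {t}" for t
    proof
      assume "T \<inter> (set xs \<union> set ys) \<subseteq> {t}"
      then show False
        using notin T(2) by (intro old_exceptional[OF T(1,2), of t]) (auto simp: n)
    qed
    obtain a1 b1 where xy: "xs = [a1]" "ys = [b1]"
      using xs ys two[of "hd xs"] two[of "hd ys"] by fastforce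
    have in_T: "a1 \<in> T" "b1 \<in> T" using two[of a1] two[of b1] unfolding xy by auto
    have ne: "a1 \<noteq> b1" using two[of a1] unfolding xy by auto
    show ?thesis
    proof (cases "card T = 3")
      case False
      then have "card T = 5" using exceptional_card[OF T(1)] by simp
      then have False by (rule exceptional_5_diamond[OF T(1) _ in_T(1)]) (use notin in auto)
      then show ?thesis ..
    next
      case T3: True
      obtain r where r: "T = {a1, b1, r}" "r \<noteq> a1" "r \<noteq> b1"
        by (rule card_3_extend2[OF T3 _ ne]) (use in_T in auto)
      have "(a1, b1) \<in> ?E" "(a1, r) \<in> ?E" "(b1, r) \<in> ?E" using exceptional_3[OF T(1) T3] r ne
        by auto
      then have e: "b1 \<in> N a1" "r \<in> N a1" "r \<in> N b1" using notin r(1) by auto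
      have rT: "r \<in> T" using r by simp
      have "r \<noteq> a" "r \<noteq> b" "r \<noteq> c" "r \<noteq> a2" "r \<noteq> b2" using T(2) rT notin by auto
      then have "a \<notin> N r" "b \<notin> N r" using N_sym[of a r] N_sym[of b r] r by (auto simp: n xy)
      then have nr: "N r = {a1, b1}" using sub[OF rT] e(2,3)[THEN N_sym] N_irrefl[of r]
        unfolding r(1) by blast
      have "a \<in> N a1" "b \<notin> N a1"
        using N_sym[of a1 a] N_sym[of b a1] common[of a1] in_n(3)[of a1] dist(1) by (auto simp: xy)
      then have "N a1 = {a, b1, r}" using sub[OF in_T(1)] e N_irrefl[of a1] unfolding r(1) by blast
      then show ?thesis using nr xy by blast
    qed
  qed
qed (use n dist len in auto)

lemma no_triangle:
  assumes "b \<in> N a" "c \<in> N a" "c \<in> N b"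
  shows False
proof -
  have ab: "{b, c} \<subseteq> N a" "{a, c} \<subseteq> N b" using assms N_sym[of b a] by auto
  have dist: "distinct [a, b, c]" using assms N_irrefl by auto
  have deg2: "N a \<noteq> {b, c}" if "{b, c} \<subseteq> N a" "{a, c} \<subseteq> N b" "distinct [a, b, c]" for a b
  proof
    assume na: "N a = {b, c}"
    have d: "distinct [a, c]" using that by auto
    show False
    proof (rule N_cases2[OF that(2) d])
      show "N b = {a, c} \<Longrightarrow> False" using no_pendant_triangle[OF na] by blast
    next
      fix r assume *: "N b = {a, c, r}" "distinct [a, c, r]"
      then have "r \<noteq> b" using N_irrefl[of b] by auto
      then show False using triangle_degree_2[OF na, of r "[]"] * that by auto
    next
      fix r s assume *: "N b = {a, c, r, s}" "distinct [a, c, r, s]"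
      then have "r \<noteq> b" "s \<noteq> b" using N_irrefl[of b] by auto
      then show False using triangle_degree_2[OF na, of r "[s]"] * that by auto
    qed
  qed
  have lists: "\<exists>r xs. N a = {b, c, r} \<union> set xs \<and> distinct ([a, b, c, r] @ xs) \<and> length xs \<le> 1"
    if "{b, c} \<subseteq> N a" "distinct [a, b, c]" "N a \<noteq> {b, c}" for a b
  proof -
    have "distinct [b, c]" using that by auto
    then show ?thesis
    proof (rule N_cases2[OF that(1)])
      show "N a = {b, c} \<Longrightarrow> ?thesis" using that by blast
    next
      fix r assume *: "N a = {b, c, r}" "distinct [b, c, r]"
      then have "r \<noteq> a" using N_irrefl[of a] by auto
      then show ?thesis using * that by (intro exI[of _ r] exI[of _ "[]"]) auto
    next
      fix r s assume *: "N a = {b, c, r, s}" "distinct [b, c, r, s]"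
      then have "r \<noteq> a" "s \<noteq> a" using N_irrefl[of a] by auto
      then show ?thesis using * that by (intro exI[of _ r] exI[of _ "[s]"]) auto
    qed
  qed
  have dist': "distinct [b, a, c]" using dist by auto
  obtain a2 xs where a2: "N a = {b, c, a2} \<union> set xs" "distinct ([a, b, c, a2] @ xs)" "length xs \<le> 1"
    using lists[OF ab(1) dist deg2[OF ab dist]] by blast
  obtain b2 ys where b2: "N b = {a, c, b2} \<union> set ys" "distinct ([b, a, c, b2] @ ys)" "length ys \<le> 1"
    using lists[OF ab(2) dist' deg2[OF ab(2,1) dist']] by blast
  have b2': "distinct ([a, b, c, b2] @ ys)" using b2(2) by auto
  obtain a1 b1 r where *: "xs = [a1]" "ys = [b1]" "N a1 = {a, b1, r}" "N r = {a1, b1}"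
    using triangle_degree_ge_3[OF a2(1) b2(1) a2(2) b2' a2(3) b2(3)] by blast
  \<comment> \<open>Exchanging \<open>b1\<close> and \<open>b2\<close> makes \<open>b2\<close> a
    neighbour of \<open>a1\<close> too, hence equal to \<open>r\<close>. But \<open>r\<close> has
    only the neighbours \<open>a1\<close> and \<open>b1\<close>, whereas \<open>b2\<close> is
    adjacent to \<open>b\<close>.\<close>
  have "N b = {a, c, b1} \<union> set [b2]" "distinct ([a, b, c, b1] @ [b2])" using b2 * by auto
  then obtain r' where r': "N a1 = {a, b2, r'}" "N r' = {a1, b2}"
    using triangle_degree_ge_3[OF a2(1) _ a2(2) _ a2(3), of b1 "[b2]"] * by auto
  have "b2 \<in> {a, b1, r}" using r'(1) *(3) by blast
  then have "b2 = r" using b2(2) * by auto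
  moreover have "b \<in> N b2" using b2(1) N_sym[of b2 b] by simp
  ultimately have "b = a1 \<or> b = b1" using *(4) by auto
  then show False using a2(2) b2(2) * by auto
qed

section \<open>The triangle-free case\<close>

text \<open>Only \<open>x1 x2\<close> is new in the triangle \<open>T\<close>. Without old triangles
  \<open>x1\<close> has just the neighbours \<open>a\<close> and \<open>r\<close>, which are not
  adjacent, so \<open>x1\<close> is suppressible.\<close>

lemma triangle_free_exceptional_3:
  assumes T: "exceptional (del {a, b} \<union> F) T" "T \<subseteq> V - {a, b}" "card T = 3"
    and x: "x1 \<in> T" "x2 \<in> T" "x1 \<noteq> x2" "{x1, x2} \<subseteq> N a" "b \<in> N a"
    and F: "\<And>p q. (p, q) \<in> F \<Longrightarrow> p \<in> T \<Longrightarrow> q \<in> T \<Longrightarrow> {p, q} = {x1, x2}"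
  shows False
proof -
  obtain r where r: "T = {x1, x2, r}" "r \<noteq> x1" "r \<noteq> x2"
    by (rule card_3_extend2[OF T(3) _ x(3)]) (use x in auto)
  have "(x1, r) \<in> del {a, b} \<union> F" "(x2, r) \<in> del {a, b} \<union> F" using exceptional_3[OF T(1,3)] r
    by auto
  then have rN: "r \<in> N x1" "r \<in> N x2"
    using F[of x1 r] F[of x2 r] r by (auto simp: doubleton_eq_iff)
  have mem: "a \<in> N x1" using x N_sym by blast
  have "x2 \<notin> N x1" "r \<notin> N a" "b \<notin> N x1"
    using no_triangle[of x1 a x2] no_triangle[of x1 a r] no_triangle[of x1 a b] x rN by auto
  moreover have "N x1 \<subseteq> {a, b} \<union> T" using exceptional_del_closed[OF T(1,2) x(1)] by blast
  ultimately have "N x1 = {a, r}" using mem rN N_irrefl[of x1] unfolding r(1) by blast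
  moreover have "a \<noteq> r" using r T(2) by auto
  ultimately show False using no_suppressible[of x1 a r] \<open>r \<notin> N a\<close> by blast
qed

lemma triangle_free_old:
  assumes T: "exceptional (del S \<union> F) T" "T \<inter> Domain F = {}"
  shows False
proof (cases "card T = 3")
  case True
  then obtain p q r where T3: "T = {p, q, r}" "distinct [p, q, r]" by (auto simp: card_3_iff)
  have "(p, q) \<in> del S \<union> F" "(p, r) \<in> del S \<union> F" "(q, r) \<in> del S \<union> F"
    using exceptional_3[OF T(1) True] T3 by auto
  then have "q \<in> N p" "r \<in> N p" "r \<in> N q" using T(2) T3(1) by auto
  then show False by (rule no_triangle)
next
  case False
  then have T5: "card T = 5" using exceptional_card[OF T(1)] by simp
  then obtain c where "c \<in> T" by fastforce
  then show False using T(2) by (intro exceptional_5_diamond[OF T(1) T5]) auto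
qed

lemma triangle_free_degree_ge_3:
  assumes n: "N a = {b, x1, x2} \<union> set xs" "N b = {a, y1, y2} \<union> set ys"
    and dist: "distinct ([a, b, x1, x2] @ xs)" "distinct ([a, b, y1, y2] @ ys)"
    and len: "length xs \<le> 1" "length ys \<le> 1"
  shows False
proof (rule reduce_one_trail_each[of a b x1 x2 xs y1 y2 ys])
  have disj: "t \<notin> N b" if "t \<in> N a" for t using no_triangle[of b a t] that n by auto
  have in_n: "{x1, x2} \<subseteq> N a" "{y1, y2} \<subseteq> N b" "b \<in> N a" "a \<in> N b" using n by auto
  show "distinct (xs @ ys)" using dist disj n by auto
  show "(x1, x2) \<notin> E" "(y1, y2) \<notin> E" using no_triangle[of x1 a x2] no_triangle[of y1 b y2] in_n
    by auto
  have ne: "x1 \<noteq> y1" "x1 \<noteq> y2" "x2 \<noteq> y1" "x2 \<noteq> y2" using disj in_n by blast+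
  then show "{x1, x2} \<noteq> {y1, y2}" by (auto simp: doubleton_eq_iff)
  fix T
  let ?E = "del {a, b} \<union> (edge x1 x2 \<union> edge y1 y2)"
  assume T: "exceptional ?E T" "T \<subseteq> V - {a, b}"
  have cl: "(p, q) \<in> ?E \<Longrightarrow> p \<in> T \<Longrightarrow> q \<in> T" for p q using exceptional_closed[OF T(1)] .
  have e: "(x1, x2) \<in> ?E" "(x2, x1) \<in> ?E" "(y1, y2) \<in> ?E" "(y2, y1) \<in> ?E" by simp_all
  have x: "x1 \<in> T \<longleftrightarrow> x2 \<in> T" and y: "y1 \<in> T \<longleftrightarrow> y2 \<in> T" using e[THEN cl] by blast+
  have T': "exceptional (del {b, a} \<union> (edge x1 x2 \<union> edge y1 y2)) T" "T \<subseteq> V - {b, a}"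
    using T by (simp_all add: insert_commute)
  consider "x1 \<in> T" "y1 \<in> T" | "x1 \<in> T" "y1 \<notin> T" | "x1 \<notin> T" "y1 \<in> T" | "x1 \<notin> T" "y1 \<notin> T" by blast
  then show False
  proof cases
    case 1
    then have T4: "{x1, x2, y1, y2} \<subseteq> T" "distinct [x1, x2, y1, y2]" using x y ne dist by auto
    have T5: "card T = 5" by (rule exceptional_4_imp_5[OF T(1) T4])
    obtain q where q: "T = {x1, x2, y1, y2, q}" "distinct [x1, x2, y1, y2, q]"
      by (rule card_5_extend4[OF T5 T4])
    \<comment> \<open>The triangles \<open>x1 y1 q\<close> and \<open>x2 y2 q\<close> contain no new
      edge and share no edge, so the single missing pair leaves one of them intact as an old
      triangle.\<close>
    have one: "t \<in> N s \<or> t' \<in> N s'"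
      if "s \<in> {x1, y1}" "s' \<in> {x2, y2}" "t \<in> {q, y1}" "t' \<in> {q, y2}" "s \<noteq> t" "s' \<noteq> t'" for s t s' t'
      using exceptional_one_missing[OF T(1) T5, of s t s' t'] that q
        by (auto simp: doubleton_eq_iff)
    have "q \<in> N x1 \<and> y1 \<in> N x1 \<and> q \<in> N y1 \<or> q \<in> N x2 \<and> y2 \<in> N x2 \<and> q \<in> N y2"
      using one[of x1 x2 q q] one[of x1 x2 q y2] one[of x1 y2 q q] one[of x1 x2 y1 q] one[of x1 x2 y1 y2]
        one[of x1 y2 y1 q] one[of y1 x2 q q] one[of y1 x2 q y2] one[of y1 y2 q q] q(2) by auto
    then show False using no_triangle[of y1 x1 q] no_triangle[of y2 x2 q] by blast
  next
    case 2
    show False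
    proof (cases "card T = 3")
      case True
      show False
        by (rule triangle_free_exceptional_3[OF T True, of x1 x2]) (use 2 x y in_n dist in auto)
    next
      case False
      then have "card T = 5" using exceptional_card[OF T(1)] by simp
      then show False by (rule exceptional_5_diamond[OF T(1) _ 2(1)]) (use 2 y in auto)
    qed
  next
    case 3
    show False
    proof (cases "card T = 3")
      case True
      show False
        by (rule triangle_free_exceptional_3[OF T' True, of y1 y2]) (use 3 x y in_n dist in auto)
    next
      case False
      then have "card T = 5" using exceptional_card[OF T(1)] by simp
      then show False by (rule exceptional_5_diamond[OF T(1) _ 3(2)]) (use 3 x in auto)
    qed
  next
    case 4
    show False by (rule triangle_free_old[OF T(1)]) (use 4 x y in auto)
  qed
qed (use n dist len in auto)

lemma triangle_free_degree_1:
  assumes n: "N a = {b}" "N b = {a, y1, y2} \<union> set ys"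
    and dist: "distinct ([a, b, y1, y2] @ ys)" and len: "length ys \<le> 1"
  shows False
proof (rule reduce_one_trail[of a b "{}" y1 y2 "set ys" "[a, b] @ ys"])
  have ys: "ys = [] \<or> (\<exists>y. ys = [y])" using len by (cases ys; cases "tl ys") auto
  show "N a = insert b {}" "N b = {a, y1, y2} \<union> set ys" by (rule n)+
  show "path_edges ([a, b] @ ys) = edge a b \<union> star a {} \<union> star b (set ys)"
    using ys by (elim disjE exE) (simp_all add: edge_commute Un_ac)
  have in_n: "{y1, y2} \<subseteq> N b" "a \<in> N b" using n by auto
  show "(y1, y2) \<notin> E" using no_triangle[of y1 b y2] in_n by auto
  fix T
  let ?E = "del {a, b} \<union> edge y1 y2"
  assume T: "exceptional ?E T" "T \<subseteq> V - {a, b}"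
  have cl: "(p, q) \<in> ?E \<Longrightarrow> p \<in> T \<Longrightarrow> q \<in> T" for p q using exceptional_closed[OF T(1)] .
  have e: "(y1, y2) \<in> ?E" "(y2, y1) \<in> ?E" by simp_all
  have T': "exceptional (del {b, a} \<union> edge y1 y2) T" "T \<subseteq> V - {b, a}"
    using T by (simp_all add: insert_commute)
  have y: "y1 \<in> T \<longleftrightarrow> y2 \<in> T" using e[THEN cl] by blast
  show False
  proof (cases "y1 \<in> T")
    case False
    then show False using y by (intro triangle_free_old[OF T(1)]) auto
  next
    case True
    show False
    proof (cases "card T = 3")
      case T3: True
      show False
        by (rule triangle_free_exceptional_3[OF T' T3, of y1 y2]) (use True y in_n dist in auto)
    next
      case False
      then have "card T = 5" using exceptional_card[OF T(1)] by simp
      then show False by (rule exceptional_5_diamond[OF T(1) _ True]) auto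
    qed
  qed
qed (use dist in auto)

text \<open>Degree 2 is impossible by now: adjacent neighbours give a triangle, non-adjacent ones
  make \<open>a\<close> suppressible.\<close>

lemma degree_shape:
  assumes "b \<in> N a"
  shows "N a = {b} \<or> (\<exists>x1 x2 xs. N a = {b, x1, x2} \<union> set xs \<and> distinct ([a, b, x1, x2] @ xs) \<and>
    length xs \<le> 1)"
proof (rule N_cases1[OF assms])
  show "N a = {b} \<Longrightarrow> ?thesis" by blast
next
  fix q assume *: "N a = {b, q}" "distinct [b, q]"
  then have "q \<in> N b" using no_suppressible[of a b q] by auto
  then show ?thesis using no_triangle[of b a q] * by auto
next
  fix q r assume *: "N a = {b, q, r}" "distinct [b, q, r]"
  then have "a \<notin> {b, q, r}" using N_irrefl[of a] by auto
  then have "N a = {b, q, r} \<union> set []" "distinct ([a, b, q, r] @ [])" "length [] \<le> 1" using *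
    by auto
  then show ?thesis by blast
next
  fix q r s assume *: "N a = {b, q, r, s}" "distinct [b, q, r, s]"
  then have "a \<notin> {b, q, r, s}" using N_irrefl[of a] by auto
  then have "N a = {b, q, r} \<union> set [s]" "distinct ([a, b, q, r] @ [s])" "length [s] \<le> 1" using *
    by auto
  then show ?thesis by blast
qed

lemma no_min_counterexample: False
proof -
  have "E \<noteq> {}" using not_decomposable decomposable.empty by blast
  then obtain a b where "(a, b) \<in> E" by auto
  then have b: "b \<in> N a" by simp
  then have a: "a \<in> N b" by (rule N_sym)
  have mixed: False if n: "N a = {b}" "N b = {a, y1, y2} \<union> set ys" "distinct ([b, a, y1, y2] @ ys)"
      "length ys \<le> 1" for a b y1 y2 ys
    by (rule triangle_free_degree_1[OF n(1,2) _ n(4)]) (use n(3) in auto)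
  consider "N a = {b}" "N b = {a}"
    | y1 y2 ys where "N a = {b}" "N b = {a, y1, y2} \<union> set ys" "distinct ([b, a, y1, y2] @ ys)"
        "length ys \<le> 1"
    | x1 x2 xs where "N b = {a}" "N a = {b, x1, x2} \<union> set xs" "distinct ([a, b, x1, x2] @ xs)"
        "length xs \<le> 1"
    | x1 x2 xs y1 y2 ys where "N a = {b, x1, x2} \<union> set xs" "distinct ([a, b, x1, x2] @ xs)"
        "length xs \<le> 1" "N b = {a, y1, y2} \<union> set ys" "distinct ([b, a, y1, y2] @ ys)"
          "length ys \<le> 1"
    using degree_shape[OF b] degree_shape[OF a] by (elim disjE exE conjE) metis+
  then show False
  proof cases
    case 1
    show False
    proof (rule closed_small[of "{a, b}"])
      show "{a, b} \<subseteq> V" using N_V[OF b] by simp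
      show "N x \<subseteq> {a, b}" if "x \<in> {a, b}" for x
        using that by (elim insertE emptyE) (simp_all add: 1)
      have ne: "a \<noteq> b" using b N_irrefl by blast
      have "decomposable (path_edges [a, b]) 1" using ne by (intro decomposable_path) simp
      moreover have "(\<Union>x\<in>{a, b}. star x (N x)) = path_edges [a, b]" by (simp add: 1 edge_commute)
      moreover have "card {a, b} div 2 = 1" using ne by simp
      ultimately show "decomposable (\<Union>x\<in>{a, b}. star x (N x)) (card {a, b} div 2)" by simp
    qed simp
  next
    case (2 y1 y2 ys)
    then show False by (rule mixed)
  next
    case (3 x1 x2 xs)
    then show False by (rule mixed)
  next
    case (4 x1 x2 xs y1 y2 ys)
    show False by (rule triangle_free_degree_ge_3[OF 4(1,4,2) _ 4(3,6)]) (use 4(5) in auto)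
  qed
qed

end

lemma exceptional_on_closed:
  assumes "exceptional (E \<inter> W \<times> W) T" "sym E" "E `` W \<subseteq> W"
  shows "exceptional E T"
proof -
  let ?E = "E \<inter> W \<times> W"
  have TW: "T \<subseteq> W"
  proof
    fix t assume "t \<in> T"
    have "?E `` {t} \<noteq> {}"
    proof
      assume e: "?E `` {t} = {}"
      then have "2 \<le> card (?E `` {t})"
        by (intro exceptional_degree_2[OF assms(1) \<open>t \<in> T\<close>]) simp
      then show False using e by simp
    qed
    then show "t \<in> W" by blast
  qed
  have "E `` T \<subseteq> T"
  proof
    fix s assume "s \<in> E `` T"
    then obtain t where t: "t \<in> T" "(t, s) \<in> E" by blast
    then have "(t, s) \<in> ?E" using TW assms(3) by blast
    then show "s \<in> T" using exceptional_closed[OF assms(1)] t(1) by blast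
  qed
  moreover have "near_complete E T" if "near_complete ?E T"
    using that unfolding near_complete_def by blast
  moreover have "T \<times> T - Id \<subseteq> E" if "T \<times> T - Id \<subseteq> ?E" using that by blast
  ultimately show ?thesis using assms(1) unfolding exceptional_def by blast
qed

theorem gallai_max_degree_4:
  fixes V :: "'a set"
  shows "graph4 V E \<Longrightarrow> (\<And>T. \<not> exceptional E T) \<Longrightarrow> decomposable E (card V div 2)"
proof (induction "card V" arbitrary: V E rule: less_induct)
  case less
  have fin: "finite V" and EV: "E \<subseteq> V \<times> V" and sym: "sym E" and irr: "irrefl E"
    and deg: "\<And>x. card (E `` {x}) \<le> 4"
    using less.prems(1) by (auto simp: graph4_def)
  show ?case
  proof (rule ccontr)
    assume nd: "\<not> decomposable E (card V div 2)"
    \<comment> \<open>A closed proper part and its complement are both smaller and inherit the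
      absence of exceptional sets; their path bounds add up to at most
      \<open>card V div 2\<close>.\<close>
    have conn: "W = V" if W: "W \<subseteq> V" "W \<noteq> {}" "E `` W \<subseteq> W" for W
    proof (rule ccontr)
      assume "W \<noteq> V"
      have finN: "finite (E `` {x})" for x
        using finite_subset[OF _ fin, of "E `` {x}"] EV by blast
      have sub: "decomposable (E \<inter> U \<times> U) (card U div 2)"
        if "U \<subset> V" "E `` U \<subseteq> U" for U
      proof (rule less.hyps)
        show "card U < card V" using that(1) fin by (rule psubset_card_mono[rotated])
        have "card ((E \<inter> U \<times> U) `` {x}) \<le> 4" for x
          by (rule order_trans[OF card_mono[OF finN] deg[of x]]) blast
        then show "graph4 U (E \<inter> U \<times> U)"
          using that(1) fin sym irr finite_subset[of U V]
          by (auto simp: graph4_def sym_def irrefl_def)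
        show "\<not> exceptional (E \<inter> U \<times> U) T" for T
          using exceptional_on_closed[OF _ sym that(2)] less.prems(2) by blast
      qed
      have "E `` (V - W) \<subseteq> V - W"
        using W(3) EV sym by (auto dest: symD)
      then have
        "decomposable ((E \<inter> W \<times> W) \<union> (E \<inter> (V - W) \<times> (V - W))) (card W div 2 + card (V - W) div 2)"
        using W \<open>W \<noteq> V\<close> by (intro decomposable_Un sub) auto
      moreover have "(E \<inter> W \<times> W) \<union> (E \<inter> (V - W) \<times> (V - W)) = E"
        using W(3) EV \<open>E `` (V - W) \<subseteq> V - W\<close> by blast
      moreover have "card W div 2 + card (V - W) div 2 \<le> card V div 2"
        using card_mono[OF fin W(1)] card_Diff_subset[OF finite_subset[OF W(1) fin] W(1)]
          by linarith
      ultimately show False using nd decomposable_mono by metis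
    qed
    interpret min_counterexample V E
    proof
      show "graph4 V E" "\<not> exceptional E T" "\<not> decomposable E (card V div 2)" for T
        using less.prems nd by blast+
      show "W \<subseteq> V \<Longrightarrow> W \<noteq> {} \<Longrightarrow> E `` W \<subseteq> W \<Longrightarrow> W = V" for W by (rule conn)
      show "decomposable E' (card V' div 2)"
        if "card V' < card V" "graph4 V' E'" "\<And>T. \<not> exceptional E' T" for V' :: "'a set" and E'
        using less.hyps that by blast
    qed
    show False by (rule no_min_counterexample)
  qed
qed

subsection \<open>Path decompositions of pair graphs\<close>

lemma path_edges_eq_parcs: "path_edges p = parcs (path_graph p)"
proof -
  have "path_edges p = set (vwalk_arcs p) \<union> (set (vwalk_arcs p))\<inverse>"
    by (induction p rule: path_edges.induct) (auto simp: edge_def)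
  then show ?thesis by (simp add: path_graph_def)
qed

lemma decomposable_imp_disjoint_paths:
  assumes "pair_graph G" "decomposable E k" "E \<subseteq> parcs G"
  shows "\<exists>D. finite D \<and> card D \<le> k \<and> (\<forall>P\<in>D. is_path_of P G) \<and>
    (\<forall>P\<in>D. \<forall>Q\<in>D. P \<noteq> Q \<longrightarrow> parcs P \<inter> parcs Q = {}) \<and> (\<Union>P\<in>D. parcs P) = E"
  using assms(2,3)
proof (induction rule: decomposable.induct)
  case (empty k)
  then show ?case by (intro exI[of _ "{}"]) simp
next
  case (add_path E k p)
  interpret pair_graph G by fact
  obtain D where D: "finite D" "card D \<le> k" "\<forall>P\<in>D. is_path_of P G"
      "\<forall>P\<in>D. \<forall>Q\<in>D. P \<noteq> Q \<longrightarrow> parcs P \<inter> parcs Q = {}" "(\<Union>P\<in>D. parcs P) = E"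
    using add_path by auto
  show ?case
  proof (cases "path_edges p = {}")
    \<comment> \<open>A list without edges is dropped: it may be empty or consist of a vertex
      outside \<open>G\<close>, and so need not be a path of \<open>G\<close>.\<close>
    case True
    then show ?thesis using D by (intro exI[of _ D]) auto
  next
    case False
    then obtain u v where uv: "(u, v) \<in> path_edges p" by auto
    have "x \<in> pverts G" if x: "x \<in> set p" for x
    proof -
      obtain y where "(x, y) \<in> path_edges p" using path_vertex_covered[OF x uv] by blast
      then show ?thesis using add_path.prems in_arcsD1 by auto
    qed
    moreover have "set (vwalk_arcs p) \<subseteq> parcs G"
      using add_path.prems unfolding path_edges_eq_parcs by (auto simp: path_graph_def)
    moreover have "p \<noteq> []" using uv by auto
    ultimately have "vpath p (with_proj G)"
      using add_path.hyps(2) by (auto simp: vpath_def vwalk_def)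
    then have p: "is_path_of (path_graph p) G" unfolding is_path_of_def by blast
    have disj: "parcs (path_graph p) \<inter> parcs P = {}" if "P \<in> D" for P
      using add_path.hyps(3) D(5) that unfolding path_edges_eq_parcs by blast
    show ?thesis
    proof (intro exI[of _ "insert (path_graph p) D"] conjI)
      show "finite (insert (path_graph p) D)" using D(1) by simp
      show "card (insert (path_graph p) D) \<le> Suc k" using D(1,2) by (simp add: card_insert_if)
      show "\<forall>P\<in>insert (path_graph p) D. is_path_of P G" using D(3) p by simp
      show "\<forall>P\<in>insert (path_graph p) D. \<forall>Q\<in>insert (path_graph p) D.
          P \<noteq> Q \<longrightarrow> parcs P \<inter> parcs Q = {}"
        using D(4) disj by (simp add: Int_commute)
      show "(\<Union>P\<in>insert (path_graph p) D. parcs P) = E \<union> path_edges p"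
        using D(5) by (auto simp: path_edges_eq_parcs)
    qed
  qed
qed

lemma pn_le_if_decomposable:
  assumes "pair_graph G" "decomposable (parcs G) k"
  shows "pn G \<le> k"
proof -
  obtain D where D: "finite D" "card D \<le> k" "path_decomposition G D"
    using decomposable_imp_disjoint_paths[OF assms order_refl] unfolding path_decomposition_def
      by blast
  then have "pn G \<le> card D" unfolding pn_def by (intro Least_le) blast
  then show ?thesis using D(2) by simp
qed

text \<open>In a symmetric digraph connectedness gives directed reachability, and membership in
  \<open>W\<close> propagates along arcs.\<close>

lemma closed_eq_pverts:
  assumes "pair_graph G" "connected (with_proj G)" "W \<subseteq> pverts G" "W \<noteq> {}" "parcs G `` W \<subseteq> W"
  shows "W = pverts G"
proof -
  interpret pair_graph G by fact
  have "symmetric (with_proj G)" by (rule sym_arcs)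
  then have sc: "strongly_connected (with_proj G)"
    using assms(2) by (rule symmetric_connected_imp_strongly_connected)
  obtain w where w: "w \<in> W" using assms(4) by blast
  have "v \<in> W" if "v \<in> pverts G" for v
  proof -
    have "w \<rightarrow>\<^sup>*\<^bsub>with_proj G\<^esub> v" using sc w that assms(3) by (auto simp: strongly_connected_def)
    then show ?thesis
    proof (induction rule: reachable_induct)
      case base
      show ?case by (rule w)
    next
      case (step x y)
      then show ?case using assms(5) by auto
    qed
  qed
  then show ?thesis using assms(3) by blast
qed

lemma graph4_pair_graph:
  assumes "pair_graph G" "max_degree G \<le> 4"
  shows "graph4 (pverts G) (parcs G)"
proof -
  interpret pair_graph G by fact
  have sub: "parcs G \<subseteq> pverts G \<times> pverts G" by (auto dest: in_arcsD1 in_arcsD2)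
  have "card (parcs G `` {x}) \<le> 4" for x
  proof (cases "x \<in> pverts G")
    case True
    have "out_arcs (with_proj G) x = Pair x ` (parcs G `` {x})" by (auto simp: out_arcs_def)
    then have "card (parcs G `` {x}) = out_degree (with_proj G) x"
      by (simp add: out_degree_def card_image inj_on_def)
    also have "\<dots> \<le> max_degree G" unfolding max_degree_def using True by (intro Max_ge) auto
    finally show ?thesis using assms(2) by simp
  next
    case False
    then have "parcs G `` {x} = {}" using sub by blast
    then show ?thesis by simp
  qed
  moreover have "(v, v) \<notin> parcs G" for v using pair_no_loops[of "(v, v)"] by auto
  then have "irrefl (parcs G)" by (simp add: irrefl_def)
  moreover have "sym (parcs G)" by (rule symI) (rule arcs_symmetric)
  ultimately show ?thesis using sub by (simp add: graph4_def)
qed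

lemma map_prod_image_inj_on:
  assumes "inj_on f V" "x \<in> V" "y \<in> V"
  shows "map_prod f f ` (V \<times> V - Id - edge x y) = f ` V \<times> f ` V - Id - edge (f x) (f y)"
proof (intro equalityI subrelI)
  fix i j assume "(i, j) \<in> map_prod f f ` (V \<times> V - Id - edge x y)"
  then obtain e where e: "(i, j) = map_prod f f e" "e \<in> V \<times> V - Id - edge x y" by (rule imageE)
  obtain u v where "e = (u, v)" by (cases e)
  then have "u \<in> V" "v \<in> V" "u \<noteq> v" "(u, v) \<notin> edge x y" "i = f u" "j = f v" using e by auto
  then show "(i, j) \<in> f ` V \<times> f ` V - Id - edge (f x) (f y)"
    using assms(2,3) by (auto simp: inj_on_eq_iff[OF assms(1)])
next
  fix i j assume "(i, j) \<in> f ` V \<times> f ` V - Id - edge (f x) (f y)"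
  then have ij: "i \<in> f ` V" "j \<in> f ` V" "i \<noteq> j" "(i, j) \<notin> edge (f x) (f y)" by simp_all
  obtain u v where uv: "u \<in> V" "v \<in> V" "i = f u" "j = f v" using ij(1,2) by blast
  then have "(u, v) \<in> V \<times> V - Id - edge x y" using ij(3,4) by auto
  then have "map_prod f f (u, v) \<in> map_prod f f ` (V \<times> V - Id - edge x y)" by (rule imageI)
  then show "(i, j) \<in> map_prod f f ` (V \<times> V - Id - edge x y)" by (simp add: uv(3,4))
qed

lemma graph_iso_complete_graph:
  assumes "pair_graph G" "card (pverts G) = k" "0 < k"
    and "pverts G \<times> pverts G - Id \<subseteq> parcs G"
  shows "graph_iso G (complete_graph k)"
proof -
  interpret pair_graph G by fact
  have "(v, v) \<notin> parcs G" for v using pair_no_loops[of "(v, v)"] by auto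
  then have all: "parcs G = pverts G \<times> pverts G - Id"
    using assms(4) by (auto dest: in_arcsD1 in_arcsD2)
  obtain x where x: "x \<in> pverts G" using assms(2,3) by fastforce
  \<comment> \<open>With equal ends the removed pair is a loop, so the transport lemma for a missing
    edge also covers complete graphs.\<close>
  have "edge x x \<subseteq> Id" by simp
  then have eq: "parcs G = pverts G \<times> pverts G - Id - edge x x" unfolding all by blast
  obtain f where f: "bij_betw f (pverts G) {..<k}"
    using ex_bij_betw_finite_nat[OF pair_finite_verts] assms(2) by (auto simp: atLeast0LessThan)
  then have inj: "inj_on f (pverts G)" and img: "f ` pverts G = {..<k}" by (auto simp: bij_betw_def)
  have "parcs (complete_graph k) = {..<k} \<times> {..<k} - Id - edge (f x) (f x)"
    by (auto simp: complete_graph_def)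
  then have "parcs (complete_graph k) = map_prod f f ` parcs G"
    unfolding eq map_prod_image_inj_on[OF inj x x] img .
  then show ?thesis
    unfolding graph_iso_iff[OF assms(1)] using f by (auto simp: complete_graph_def)
qed

lemma graph_iso_K5_minus:
  assumes "pair_graph G" "card (pverts G) = 5" "x \<in> pverts G" "y \<in> pverts G" "x \<noteq> y"
    and "parcs G = pverts G \<times> pverts G - Id - edge x y"
  shows "graph_iso G K5_minus"
proof -
  interpret pair_graph G by fact
  have "card (pverts G - {x, y}) = 3"
    using assms(2-5) by (simp add: card_Diff_subset)
  then obtain p q r where pqr: "pverts G - {x, y} = {p, q, r}" "p \<noteq> q" "q \<noteq> r" "p \<noteq> r"
    by (auto simp: card_3_iff)
  have V: "pverts G = {x, y, p, q, r}" using pqr(1) assms(3,4) by blast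
  have d: "distinct [x, y, p, q, r]" using pqr assms(5) by auto
  \<comment> \<open>The non-adjacent vertices go to 0 and 1, the ends of the edge removed in
    \<open>K5_minus\<close>; the other three may be numbered freely.\<close>
  define f where "f = (\<lambda>v. if v = x then 0 else if v = y then 1 else if v = p then 2
    else if v = q then 3 else (4 :: nat))"
  have f: "f x = 0" "f y = 1" "f p = 2" "f q = 3" "f r = 4" using d by (auto simp: f_def)
  have "{..<5} = {0, 1, 2, 3, 4 :: nat}" by auto
  then have bij: "bij_betw f (pverts G) {..<5}"
    using d unfolding bij_betw_def V by (auto simp: inj_on_def f)
  then have inj: "inj_on f (pverts G)" and img: "f ` pverts G = {..<5}" by (auto simp: bij_betw_def)
  have "parcs K5_minus = {..<5} \<times> {..<5} - Id - edge (f x) (f y)"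
    unfolding f by (auto simp: K5_minus_def complete_graph_def)
  then have "parcs K5_minus = map_prod f f ` parcs G"
    unfolding assms(6) map_prod_image_inj_on[OF inj assms(3,4)] img .
  moreover have "pverts K5_minus = {..<5}" by (simp add: K5_minus_def complete_graph_def)
  ultimately show ?thesis unfolding graph_iso_iff[OF assms(1)] using bij by auto
qed

theorem theorem4p1:
  fixes G :: "'a pair_pre_digraph" and n :: nat
  assumes "pair_graph G"
    and "connected (with_proj G)"
    and "card (pverts G) = n"
    and "max_degree G \<le> 4"
  shows "pn G \<le> n div 2 \<or>
    graph_iso G (complete_graph 3) \<or>
    graph_iso G (complete_graph 5) \<or>
    graph_iso G K5_minus"
proof (cases "\<exists>T. exceptional (parcs G) T")
  case False
  then have "decomposable (parcs G) (n div 2)"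
    using gallai_max_degree_4[OF graph4_pair_graph[OF assms(1,4)]] assms(3) by blast
  then show ?thesis using pn_le_if_decomposable[OF assms(1)] by blast
next
  case True
  interpret pair_graph G by fact
  have sub: "parcs G \<subseteq> pverts G \<times> pverts G" by (auto dest: in_arcsD1 in_arcsD2)
  obtain T where T: "exceptional (parcs G) T" using True by blast
  have "T \<subseteq> pverts G"
  proof
    fix t assume "t \<in> T"
    have "finite (parcs G `` {t})"
      by (rule finite_subset[OF _ pair_finite_verts]) (use sub in blast)
    then have "parcs G `` {t} \<noteq> {}" using exceptional_degree_2[OF T \<open>t \<in> T\<close>] by auto
    then show "t \<in> pverts G" using sub by blast
  qed
  moreover have "T \<noteq> {}" "parcs G `` T \<subseteq> T" using T by (auto simp: exceptional_def)
  ultimately have TV: "T = pverts G" using closed_eq_pverts[OF assms(1,2)] by blast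
  show ?thesis
  proof (cases "card T = 3")
    case True
    then have "pverts G \<times> pverts G - Id \<subseteq> parcs G" using T unfolding TV exceptional_def by auto
    then have "graph_iso G (complete_graph 3)"
      using graph_iso_complete_graph[OF assms(1)] True TV by simp
    then show ?thesis by blast
  next
    case False
    then have T5: "card (pverts G) = 5" using exceptional_card[OF T] TV by simp
    then have "near_complete (parcs G) (pverts G)" using exceptional_5[OF T] TV by simp
    then obtain x y where xy: "pverts G \<times> pverts G - Id - edge x y \<subseteq> parcs G"
      unfolding near_complete_def by blast
    show ?thesis
    proof (cases "pverts G \<times> pverts G - Id \<subseteq> parcs G")
      case True
      then show ?thesis using graph_iso_complete_graph[OF assms(1) T5] by simp
    next
      case False
      \<comment> \<open>Any non-adjacent pair must be the one exempted by
        \<open>near_complete\<close>, so no other pair is missing.\<close>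
      then obtain u v where uv: "u \<in> pverts G" "v \<in> pverts G" "u \<noteq> v" "(u, v) \<notin> parcs G" by auto
      have "(u, v) \<in> edge x y" using xy uv by blast
      then have e: "edge x y = edge u v" by (auto simp: edge_commute)
      have "(v, u) \<notin> parcs G" using uv(4) arcs_symmetric by blast
      then have "(p, q) \<notin> edge u v" "p \<noteq> q" if "(p, q) \<in> parcs G" for p q
        using that uv(4) pair_no_loops[OF that] by auto
      then have "parcs G \<subseteq> pverts G \<times> pverts G - Id - edge u v" using sub by blast
      then have "parcs G = pverts G \<times> pverts G - Id - edge u v" using xy unfolding e
        by (rule equalityI)
      then show ?thesis using graph_iso_K5_minus[OF assms(1) T5 uv(1-3)] by blast
    qed
  qed
qed

end
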